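(* Let $\lambda\in[0,1]$. The balanced 2-maxian problem on a tree $T=(V,E)$ with $n\ge 2$ vertices $v_1,\dots,v_n$, nonnegative edge lengths, nonnegative vertex weights $w_i$ and nonnegative service times $t_i$ can be solved in linear time, i.e. there is an algorithm that computes an optimal solution and the optimal objective value in $O(n)$ time.
   Context: Running time counts elementary operations (arithmetic operations and comparisons of real numbers at unit cost). $d(\cdot,\cdot)$ denotes the shortest-path distance in $T$ with respect to the edge lengths. Put $z_i=w_it_i$. Balanced 2-maxian problem on $T$ with parameter $\lambda$: a feasible solution consists of an edge $e$ of $T$, whose deletion splits $T$ into two subtrees $T_1$ and $T_2$ with vertex sets $V_1$ and $V_2$, together with two facilities (vertices) $x_1,x_2$ with $x_1\in V_2$ and $x_2\in V_1$; all vertices of $V_1$ are allocated to $x_1$ and all vertices of $V_2$ are allocated to $x_2$. The objective, to be maximized over all feasible solutions, is $$f_{pmax}=\lambda\Big(\sum_{v_i\in V_1}w_i\,d(v_i,x_1)+\sum_{v_i\in V_2}w_i\,d(v_i,x_2)\Big)-(1-\lambda)\Big|\sum_{v_i\in V_1}z_i-\sum_{v_i\in V_2}z_i\Big|.$$ *)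

theory Defs
  imports Complex_Main
begin

section \<open>Trees with edge lengths\<close>

text \<open>
  A finite simple undirected graph is given by its vertex set \<open>V\<close> and a set \<open>E\<close> of
  two-element subsets of \<open>V\<close>; edge lengths are a function on edges. Walks and paths are
  nonempty lists of vertices.
\<close>

definition simple_graph :: "'v set \<Rightarrow> 'v set set \<Rightarrow> bool" where
  "simple_graph V E \<longleftrightarrow> finite V \<and> (\<forall>e\<in>E. \<exists>u\<in>V. \<exists>v\<in>V. u \<noteq> v \<and> e = {u, v})"

definition is_walk :: "'v set \<Rightarrow> 'v set set \<Rightarrow> 'v list \<Rightarrow> bool" where
  "is_walk V E p \<longleftrightarrow> p \<noteq> [] \<and> set p \<subseteq> V \<and> successively (\<lambda>x y. {x, y} \<in> E) p"

definition is_path :: "'v set \<Rightarrow> 'v set set \<Rightarrow> 'v list \<Rightarrow> bool" where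
  "is_path V E p \<longleftrightarrow> is_walk V E p \<and> distinct p"

definition is_cycle :: "'v set \<Rightarrow> 'v set set \<Rightarrow> 'v list \<Rightarrow> bool" where
  "is_cycle V E p \<longleftrightarrow> is_path V E p \<and> 3 \<le> length p \<and> {last p, hd p} \<in> E"

definition reachable_in :: "'v set \<Rightarrow> 'v set set \<Rightarrow> 'v \<Rightarrow> 'v \<Rightarrow> bool" where
  "reachable_in V E u v \<longleftrightarrow> (\<exists>p. is_walk V E p \<and> hd p = u \<and> last p = v)"

definition is_tree :: "'v set \<Rightarrow> 'v set set \<Rightarrow> bool" where
  "is_tree V E \<longleftrightarrow> simple_graph V E \<and> V \<noteq> {} \<and>
     (\<forall>u\<in>V. \<forall>v\<in>V. reachable_in V E u v) \<and> (\<nexists>p. is_cycle V E p)"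

definition graph_components :: "'v set \<Rightarrow> 'v set set \<Rightarrow> 'v set set" where
  "graph_components V E = (\<lambda>v. {u \<in> V. reachable_in V E v u}) ` V"

fun path_length :: "('v set \<Rightarrow> real) \<Rightarrow> 'v list \<Rightarrow> real" where
  "path_length l (x # y # p) = l {x, y} + path_length l (y # p)"
| "path_length l _ = 0"

text \<open>
  In a finite connected graph the set below is finite and nonempty, so its infimum is a minimum.
\<close>

definition sp_dist :: "'v set \<Rightarrow> 'v set set \<Rightarrow> ('v set \<Rightarrow> real) \<Rightarrow> 'v \<Rightarrow> 'v \<Rightarrow> real" where
  "sp_dist V E l u v = Inf {path_length l p | p. is_path V E p \<and> hd p = u \<and> last p = v}"

section \<open>The balanced 2-maxian problem\<close>

text \<open>
  A solution is a tuple \<open>(e, V1, V2, x1, x2)\<close>. Either of the two subtrees obtained by deleting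
  \<open>e\<close> may be called \<open>V1\<close>. Each facility lies in the subtree opposite to the vertices
  it serves.
\<close>

type_synonym 'v solution = "'v set \<times> 'v set \<times> 'v set \<times> 'v \<times> 'v"

definition splits :: "'v set \<Rightarrow> 'v set set \<Rightarrow> 'v set \<Rightarrow> 'v set \<Rightarrow> 'v set \<Rightarrow> bool" where
  "splits V E e V1 V2 \<longleftrightarrow> e \<in> E \<and> V1 \<noteq> V2 \<and> graph_components V (E - {e}) = {V1, V2}"

fun feasible :: "'v set \<Rightarrow> 'v set set \<Rightarrow> 'v solution \<Rightarrow> bool" where
  "feasible V E (e, V1, V2, x1, x2) \<longleftrightarrow> splits V E e V1 V2 \<and> x1 \<in> V2 \<and> x2 \<in> V1"

fun f_pmax :: "'v set \<Rightarrow> 'v set set \<Rightarrow> ('v set \<Rightarrow> real) \<Rightarrow> ('v \<Rightarrow> real) \<Rightarrow> ('v \<Rightarrow> real) \<Rightarrow> real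
    \<Rightarrow> 'v solution \<Rightarrow> real" where
  "f_pmax V E l w t lam (e, V1, V2, x1, x2) =
     lam * ((\<Sum>v\<in>V1. w v * sp_dist V E l v x1) + (\<Sum>v\<in>V2. w v * sp_dist V E l v x2))
     - (1 - lam) * \<bar>(\<Sum>v\<in>V1. w v * t v) - (\<Sum>v\<in>V2. w v * t v)\<bar>"

definition optimal :: "'v set \<Rightarrow> 'v set set \<Rightarrow> ('v set \<Rightarrow> real) \<Rightarrow> ('v \<Rightarrow> real) \<Rightarrow> ('v \<Rightarrow> real) \<Rightarrow> real
    \<Rightarrow> 'v solution \<Rightarrow> bool" where
  "optimal V E l w t lam S \<longleftrightarrow>
     feasible V E S \<and> (\<forall>S'. feasible V E S' \<longrightarrow> f_pmax V E l w t lam S' \<le> f_pmax V E l w t lam S)"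

section \<open>Algorithms and running time\<close>

text \<open>
  Algorithms are programs of a small imperative language over the unit-cost real RAM. There are
  scalar variables and arrays holding natural numbers (used as counters, array indices and vertex
  names), and scalar variables and arrays holding real numbers. Reals admit exact arithmetic and
  comparisons, but cannot be rounded or converted to natural numbers; natural numbers admit only
  addition, truncated subtraction and comparisons. The only numeric constants in a program are
  natural and integer literals.
\<close>

type_synonym vname = string

record state =
  nvar :: "vname \<Rightarrow> nat"
  narr :: "vname \<Rightarrow> nat \<Rightarrow> nat"
  rvar :: "vname \<Rightarrow> real"
  rarr :: "vname \<Rightarrow> nat \<Rightarrow> real"

datatype nexp =
    NConst nat
  | NVar vname
  | NArr vname nexp
  | NAdd nexp nexp
  | NSub nexp nexp

datatype rexp =
    RConst int
  | RVar vname
  | RArr vname nexp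
  | RAdd rexp rexp
  | RSub rexp rexp
  | RMul rexp rexp
  | RDiv rexp rexp

datatype bexp =
    NLess nexp nexp
  | NEq nexp nexp
  | RLess rexp rexp
  | REq rexp rexp
  | BNot bexp
  | BAnd bexp bexp

datatype com =
    Skip
  | NAssign vname nexp
  | RAssign vname rexp
  | NStore vname nexp nexp  \<comment> \<open>array, index, new value\<close>
  | RStore vname nexp rexp
  | Seq com com
  | Cond bexp com com
  | While bexp com

fun nval :: "nexp \<Rightarrow> state \<Rightarrow> nat" where
  "nval (NConst k) s = k"
| "nval (NVar x) s = nvar s x"
| "nval (NArr a i) s = narr s a (nval i s)"
| "nval (NAdd a b) s = nval a s + nval b s"
| "nval (NSub a b) s = nval a s - nval b s"

fun rval :: "rexp \<Rightarrow> state \<Rightarrow> real" where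
  "rval (RConst k) s = of_int k"
| "rval (RVar x) s = rvar s x"
| "rval (RArr a i) s = rarr s a (nval i s)"
| "rval (RAdd a b) s = rval a s + rval b s"
| "rval (RSub a b) s = rval a s - rval b s"
| "rval (RMul a b) s = rval a s * rval b s"
| "rval (RDiv a b) s = rval a s / rval b s"

fun bval :: "bexp \<Rightarrow> state \<Rightarrow> bool" where
  "bval (NLess a b) s \<longleftrightarrow> nval a s < nval b s"
| "bval (NEq a b) s \<longleftrightarrow> nval a s = nval b s"
| "bval (RLess a b) s \<longleftrightarrow> rval a s < rval b s"
| "bval (REq a b) s \<longleftrightarrow> rval a s = rval b s"
| "bval (BNot b) s \<longleftrightarrow> \<not> bval b s"
| "bval (BAnd b c) s \<longleftrightarrow> bval b s \<and> bval c s"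

text \<open>
  Every node of an expression costs one unit, so arithmetic operations and comparisons are counted
  together with memory accesses; assignments and branchings cost one further unit each. The total
  thus bounds the number of arithmetic operations and comparisons from above.
\<close>

fun ncost :: "nexp \<Rightarrow> nat" where
  "ncost (NConst k) = 1"
| "ncost (NVar x) = 1"
| "ncost (NArr a i) = 1 + ncost i"
| "ncost (NAdd a b) = 1 + ncost a + ncost b"
| "ncost (NSub a b) = 1 + ncost a + ncost b"

fun rcost :: "rexp \<Rightarrow> nat" where
  "rcost (RConst k) = 1"
| "rcost (RVar x) = 1"
| "rcost (RArr a i) = 1 + ncost i"
| "rcost (RAdd a b) = 1 + rcost a + rcost b"
| "rcost (RSub a b) = 1 + rcost a + rcost b"
| "rcost (RMul a b) = 1 + rcost a + rcost b"
| "rcost (RDiv a b) = 1 + rcost a + rcost b"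

fun bcost :: "bexp \<Rightarrow> nat" where
  "bcost (NLess a b) = 1 + ncost a + ncost b"
| "bcost (NEq a b) = 1 + ncost a + ncost b"
| "bcost (RLess a b) = 1 + rcost a + rcost b"
| "bcost (REq a b) = 1 + rcost a + rcost b"
| "bcost (BNot b) = 1 + bcost b"
| "bcost (BAnd b c) = 1 + bcost b + bcost c"

text \<open>\<open>exec c s k s'\<close>: started in \<open>s\<close>, the program \<open>c\<close> terminates in \<open>s'\<close> after time \<open>k\<close>.\<close>

inductive exec :: "com \<Rightarrow> state \<Rightarrow> nat \<Rightarrow> state \<Rightarrow> bool" where
  Skip: "exec Skip s 1 s"
| NAssign: "exec (NAssign x a) s (1 + ncost a) (s\<lparr>nvar := (nvar s)(x := nval a s)\<rparr>)"
| RAssign: "exec (RAssign x a) s (1 + rcost a) (s\<lparr>rvar := (rvar s)(x := rval a s)\<rparr>)"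
| NStore: "exec (NStore x i a) s (1 + ncost i + ncost a)
    (s\<lparr>narr := (narr s)(x := (narr s x)(nval i s := nval a s))\<rparr>)"
| RStore: "exec (RStore x i a) s (1 + ncost i + rcost a)
    (s\<lparr>rarr := (rarr s)(x := (rarr s x)(nval i s := rval a s))\<rparr>)"
| Seq: "exec c1 s k1 s1 \<Longrightarrow> exec c2 s1 k2 s2 \<Longrightarrow> exec (Seq c1 c2) s (k1 + k2) s2"
| CondTrue: "bval b s \<Longrightarrow> exec c1 s k s' \<Longrightarrow> exec (Cond b c1 c2) s (1 + bcost b + k) s'"
| CondFalse: "\<not> bval b s \<Longrightarrow> exec c2 s k s' \<Longrightarrow> exec (Cond b c1 c2) s (1 + bcost b + k) s'"
| WhileFalse: "\<not> bval b s \<Longrightarrow> exec (While b c) s (1 + bcost b) s"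
| WhileTrue: "bval b s \<Longrightarrow> exec c s k1 s1 \<Longrightarrow> exec (While b c) s1 k2 s2 \<Longrightarrow>
    exec (While b c) s (1 + bcost b + k1 + k2) s2"

inductive_cases SkipE: "exec Skip s k s'"
inductive_cases NAssignE: "exec (NAssign x a) s k s'"
inductive_cases RAssignE: "exec (RAssign x a) s k s'"
inductive_cases NStoreE: "exec (NStore x i a) s k s'"
inductive_cases RStoreE: "exec (RStore x i a) s k s'"
inductive_cases SeqE: "exec (Seq c1 c2) s k s'"
inductive_cases CondE: "exec (Cond b c1 c2) s k s'"
inductive_cases WhileE: "exec (While b c) s k s'"

text \<open>Execution is deterministic, so the existence of a good run says that the run is good.\<close>

lemma exec_deterministic:
  "exec c s k s' \<Longrightarrow> exec c s k' s'' \<Longrightarrow> k' = k \<and> s'' = s'"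
proof (induction arbitrary: k' s'' rule: exec.induct)
  case (Skip s)
  show ?case by (rule SkipE[OF Skip]) simp
next
  case (NAssign x a s)
  show ?case by (rule NAssignE[OF NAssign]) simp
next
  case (RAssign x a s)
  show ?case by (rule RAssignE[OF RAssign]) simp
next
  case (NStore x i a s)
  show ?case by (rule NStoreE[OF NStore]) simp
next
  case (RStore x i a s)
  show ?case by (rule RStoreE[OF RStore]) simp
next
  case (Seq c1 s k1 s1 c2 k2 s2)
  show ?case by (rule SeqE[OF Seq.prems]) (metis Seq.IH)
next
  case (CondTrue b s c1 k s' c2)
  show ?case
    by (rule CondE[OF CondTrue.prems]) (use CondTrue.hyps in \<open>auto dest: CondTrue.IH\<close>)
next
  case (CondFalse b s c2 k s' c1)
  show ?case
    by (rule CondE[OF CondFalse.prems]) (use CondFalse.hyps in \<open>auto dest: CondFalse.IH\<close>)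
next
  case (WhileFalse b s c)
  show ?case by (rule WhileE[OF WhileFalse.prems]) (use WhileFalse.hyps in simp_all)
next
  case (WhileTrue b s c k1 s1 k2 s2)
  show ?case
  proof (rule WhileE[OF WhileTrue.prems])
    assume "\<not> bval b s"
    with WhileTrue.hyps show ?thesis by simp
  next
    fix l1 r1 l2
    assume k': "k' = Suc (bcost b + l1 + l2)"
      and body: "exec c s l1 r1" and rest: "exec (While b c) r1 l2 s''"
    have eq: "l1 = k1 \<and> r1 = s1" by (rule WhileTrue.IH(1)[OF body])
    have "l2 = k2 \<and> s'' = s2" by (rule WhileTrue.IH(2)) (use rest eq in simp)
    with k' eq show ?thesis by simp
  qed
qed

section \<open>Input and output\<close>

text \<open>
  The tree has the vertices \<open>0, \<dots>, n - 1\<close> and is presented as a list of its edges in arbitrary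
  order and with arbitrarily ordered endpoints. All other memory cells, including array cells beyond
  the stated ranges, have unspecified initial contents.
\<close>

definition listed_edge :: "state \<Rightarrow> nat \<Rightarrow> nat set" where
  "listed_edge s i = {narr s ''src'' i, narr s ''dst'' i}"

definition holds_input :: "state \<Rightarrow> nat \<Rightarrow> nat set set \<Rightarrow> (nat set \<Rightarrow> real) \<Rightarrow> (nat \<Rightarrow> real) \<Rightarrow>
    (nat \<Rightarrow> real) \<Rightarrow> real \<Rightarrow> bool" where
  "holds_input s n E l w t lam \<longleftrightarrow>
     nvar s ''n'' = n \<and>
     bij_betw (listed_edge s) {..<card E} E \<and>
     (\<forall>i<card E. rarr s ''len'' i = l (listed_edge s i)) \<and>
     (\<forall>v<n. rarr s ''w'' v = w v \<and> rarr s ''t'' v = t v) \<and>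
     rvar s ''lambda'' = lam"

text \<open>
  The output consists of the position of the deleted edge in the input list (read in the initial
  state \<open>s\<close>), the two facilities and the objective value. The edge and the facilities
  determine the sets \<open>V1\<close> and \<open>V2\<close>.
\<close>

definition holds_optimum :: "state \<Rightarrow> state \<Rightarrow> nat \<Rightarrow> nat set set \<Rightarrow> (nat set \<Rightarrow> real) \<Rightarrow>
    (nat \<Rightarrow> real) \<Rightarrow> (nat \<Rightarrow> real) \<Rightarrow> real \<Rightarrow> bool" where
  "holds_optimum s s' n E l w t lam \<longleftrightarrow>
     nvar s' ''edge'' < card E \<and>
     (\<exists>V1 V2. let S = (listed_edge s (nvar s' ''edge''), V1, V2, nvar s' ''x1'', nvar s' ''x2'')
              in optimal {..<n} E l w t lam S \<and> rvar s' ''value'' = f_pmax {..<n} E l w t lam S)"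

end

theory Submission
  imports Defs
begin

text \<open>
  For a fixed edge \<open>{a, b}\<close> with sides \<open>A \<ni> a\<close> and \<open>B \<ni> b\<close>, every vertex of \<open>A\<close> reaches its
  facility \<open>x1 \<in> B\<close> through the edge, so its total weighted distance is
  \<open>S(A, a) + W(A) (l + d(x1, b))\<close>. Since the weights are nonnegative, the best \<open>x1\<close> is a vertex of
  \<open>B\<close> farthest from \<open>b\<close>, and symmetrically for \<open>x2\<close>. Hence the optimum for one edge
  is read off from a constant-size summary of either side. Summaries of disjoint sets at the same
  vertex can be joined, and a summary can be shifted across a bridge.

  All \<open>2 (n - 1)\<close> summaries are computed by pruning leaves one at a time until only the vertex \<open>0\<close> is
  left, merging each pruned leaf into its neighbour (this gives the sides below the edges), and then
  undoing the prunings in reverse order (this gives the complementary sides).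
\<close>

section \<open>Paths and bridges\<close>

text \<open>The two facilities of one edge can be chosen separately because the imbalance term
  depends on the edge alone. \<open>join\<close> has no inverse: the maximum over a difference of
  sets cannot be recovered from maxima, so a complementary side cannot be found by subtracting a
  side from a total. Instead, when \<open>v\<close> is merged into \<open>p\<close>, the summary of
  \<open>p\<close> just before the merge is saved in the array \<open>P\<close>. Everything outside
  the side of \<open>v\<close> is this saved set together with what lies outside the enlarged set at
  \<open>p\<close>, whose summary is known when prunings are undone in reverse. A vertex of large
  degree thus costs constant time per incident edge. The graph part allows any order of prunings.
  The program has an unordered edge list and takes whichever order its leaf search produces; the
  linear bound rests on amortising that search.\<close>

lemma is_walk_Cons:
  "is_walk V E (x # q) \<longleftrightarrow> x \<in> V \<and> (q = [] \<or> {x, hd q} \<in> E \<and> is_walk V E q)"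
  by (auto simp: is_walk_def successively_Cons)

lemma is_walk_append:
  assumes "p \<noteq> []" "q \<noteq> []"
  shows "is_walk V E (p @ q) \<longleftrightarrow> is_walk V E p \<and> is_walk V E q \<and> {last p, hd q} \<in> E"
  using assms by (auto simp: is_walk_def successively_append_iff)

lemma is_path_rev [simp]: "is_path V E (rev p) \<longleftrightarrow> is_path V E p"
  by (simp add: is_path_def is_walk_def insert_commute)

lemma path_length_append:
  assumes "p \<noteq> []" "q \<noteq> []"
  shows "path_length l (p @ q) = path_length l p + l {last p, hd q} + path_length l q"
  using assms by (induction l p rule: path_length.induct) (auto simp: neq_Nil_conv)

lemma path_length_rev [simp]: "path_length l (rev p) = path_length l p"
proof (induction l p rule: path_length.induct)
  case (1 l x y p)
  then show ?case
    using path_length_append[of "rev p @ [y]" "[x]" l] by (simp add: insert_commute)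
qed simp_all

lemma path_length_nonneg:
  assumes "\<And>e. e \<in> E \<Longrightarrow> 0 \<le> l e" "is_walk V E p"
  shows "0 \<le> path_length l p"
  using assms by (induction l p rule: path_length.induct) (auto simp: is_walk_def)

lemma walk_imp_path:
  assumes "is_walk V E p"
  shows "\<exists>q. is_path V E q \<and> hd q = hd p \<and> last q = last p"
  using assms
proof (induction "length p" arbitrary: p rule: less_induct)
  case less
  show ?case
  proof (cases "distinct p")
    case True
    with less.prems show ?thesis by (auto simp: is_path_def)
  next
    case False
    then obtain xs ys zs y where p: "p = xs @ [y] @ ys @ [y] @ zs"
      using not_distinct_decomp by blast
    let ?q = "xs @ [y] @ zs"
    have "is_walk V E ?q"
      using less.prems unfolding p is_walk_def
      by (auto simp: successively_append_iff successively_Cons)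
    moreover have "hd ?q = hd p" "last ?q = last p" "length ?q < length p"
      by (auto simp: p hd_append)
    ultimately show ?thesis using less.hyps by metis
  qed
qed

lemma sp_dist_commute: "sp_dist V E l u v = sp_dist V E l v u"
proof -
  have "{path_length l p | p. is_path V E p \<and> hd p = a \<and> last p = b}
      \<subseteq> {path_length l p | p. is_path V E p \<and> hd p = b \<and> last p = a}" for a b
    by clarify (metis hd_rev last_rev is_path_rev path_length_rev)
  then show ?thesis unfolding sp_dist_def by (intro arg_cong[where f = Inf] subset_antisym)
qed

lemma sp_dist_self:
  assumes "v \<in> V"
  shows "sp_dist V E l v v = 0"
proof -
  have "is_path V E p \<and> hd p = v \<and> last p = v \<longleftrightarrow> p = [v]" for p
    using assms by (cases p) (auto simp: is_path_def is_walk_def split: if_splits)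
  then show ?thesis by (simp add: sp_dist_def)
qed

text \<open>The side and the direction are arguments, so that each fact about one side carries over
  to the other by \<open>bridge_commute\<close>. A unique crossing edge is a local condition;
  connectedness of the tree later turns the two sides into components.\<close>

definition bridge :: "'v set \<Rightarrow> 'v set set \<Rightarrow> 'v set \<Rightarrow> 'v \<Rightarrow> 'v \<Rightarrow> bool" where
  "bridge V E A a b \<longleftrightarrow> A \<subseteq> V \<and> a \<in> A \<and> b \<in> V - A \<and> {a, b} \<in> E \<and>
     (\<forall>x y. {x, y} \<in> E \<longrightarrow> x \<in> A \<longrightarrow> y \<in> V - A \<longrightarrow> x = a \<and> y = b)"

lemma bridge_commute:
  assumes "bridge V E A a b"
  shows "bridge V E (V - A) b a"
proof -
  have "x = b \<and> y = a" if "{x, y} \<in> E" "x \<in> V - A" "y \<in> A" for x y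
  proof -
    have "{y, x} \<in> E" using that(1) by (simp add: insert_commute)
    with assms that show ?thesis by (auto simp: bridge_def)
  qed
  with assms show ?thesis by (auto simp: bridge_def double_diff insert_commute)
qed

text \<open>A path repeats no vertex, so it uses the only crossing edge at most once. Both cases are
  proved together and for arbitrary \<open>A\<close>, since after a crossing the rest of the path is
  an instance for the complement.\<close>

lemma path_crossing:
  assumes "is_path V E q" "bridge V E A a b" "hd q \<in> A"
  shows "(last q \<in> A \<longrightarrow> set q \<subseteq> A) \<and>
    (last q \<in> V - A \<longrightarrow> (\<exists>q1 q2. q = q1 @ q2 \<and> q1 \<noteq> [] \<and> q2 \<noteq> [] \<and> set q1 \<subseteq> A \<and> set q2 \<subseteq> V - A \<and>
       last q1 = a \<and> hd q2 = b))"
  using assms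
proof (induction q arbitrary: A a b)
  case Nil
  then show ?case by (simp add: is_path_def is_walk_def)
next
  case (Cons x q)
  show ?case
  proof (cases "q = []")
    case True
    with Cons.prems show ?thesis by auto
  next
    case False
    then have q: "is_path V E q" "{x, hd q} \<in> E" "hd q \<in> V" "x \<notin> set q" "x \<in> A"
      using Cons.prems(1,3) by (auto simp: is_path_def is_walk_Cons) (auto simp: is_walk_def)
    show ?thesis
    proof (cases "hd q \<in> A")
      case True
      note IH = Cons.IH[OF q(1) Cons.prems(2) True]
      show ?thesis
      proof (intro conjI impI)
        assume "last (x # q) \<in> A"
        then show "set (x # q) \<subseteq> A" using IH False q by auto
      next
        assume "last (x # q) \<in> V - A"
        then obtain q1 q2 where "q = q1 @ q2" "q1 \<noteq> []" "q2 \<noteq> []" "set q1 \<subseteq> A" "set q2 \<subseteq> V - A"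
          "last q1 = a" "hd q2 = b" using IH False by auto
        then show "\<exists>q1 q2. x # q = q1 @ q2 \<and> q1 \<noteq> [] \<and> q2 \<noteq> [] \<and> set q1 \<subseteq> A \<and> set q2 \<subseteq> V - A \<and>
            last q1 = a \<and> hd q2 = b"
          using q by (intro exI[of _ "x # q1"] exI[of _ q2]) auto
      qed
    next
      case out: False
      with Cons.prems(2) q have ab: "x = a" "hd q = b" by (auto simp: bridge_def)
      note IH = Cons.IH[OF q(1) bridge_commute[OF Cons.prems(2)]]
      have AV: "A \<subseteq> V" using Cons.prems(2) by (simp add: bridge_def)
      show ?thesis
      proof (intro conjI impI)
        \<comment> \<open>Returning to \<open>A\<close> would visit \<open>a\<close>, that is
          \<open>x\<close>, a second time: this case is contradictory.\<close>
        assume "last (x # q) \<in> A"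
        then obtain q1 q2 where "q = q1 @ q2" "q2 \<noteq> []" "hd q2 = a"
          using IH out q False AV by (auto simp: double_diff)
        then have "x \<in> set q" using ab by (cases q2) auto
        with q show "set (x # q) \<subseteq> A" by simp
      next
        assume "last (x # q) \<in> V - A"
        then have "set q \<subseteq> V - A" using IH out q False by auto
        then show "\<exists>q1 q2. x # q = q1 @ q2 \<and> q1 \<noteq> [] \<and> q2 \<noteq> [] \<and> set q1 \<subseteq> A \<and> set q2 \<subseteq> V - A \<and>
            last q1 = a \<and> hd q2 = b"
          using q ab False by (intro exI[of _ "[x]"] exI[of _ q]) auto
      qed
    qed
  qed
qed

section \<open>Distances and components of a weighted tree\<close>

locale weighted_tree =
  fixes V :: "'v set" and E :: "'v set set" and l :: "'v set \<Rightarrow> real"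
  assumes tree: "is_tree V E" and len_nonneg: "\<And>e. e \<in> E \<Longrightarrow> 0 \<le> l e"
begin

abbreviation d where "d \<equiv> sp_dist V E l"

lemma finite_V: "finite V"
  using tree by (simp add: is_tree_def simple_graph_def)

lemma edgeE:
  assumes "e \<in> E"
  obtains u v where "u \<in> V" "v \<in> V" "u \<noteq> v" "e = {u, v}"
  using assms tree unfolding is_tree_def simple_graph_def by blast

lemma edgeD:
  assumes "{x, y} \<in> E"
  shows "x \<in> V" "y \<in> V" "x \<noteq> y"
  using edgeE[OF assms] by (auto simp: doubleton_eq_iff)

lemma edge_subset: "e \<in> E \<Longrightarrow> e \<subseteq> V"
  by (erule edgeE) simp

lemma finite_E: "finite E"
  by (rule finite_subset[of _ "Pow V"]) (use finite_V edge_subset in auto)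

lemma obtain_path:
  assumes "u \<in> V" "v \<in> V"
  obtains p where "is_path V E p" "hd p = u" "last p = v"
  using tree assms unfolding is_tree_def reachable_in_def by (metis walk_imp_path)

lemma dist_set_bdd:
  "bdd_below {path_length l p | p. is_path V E p \<and> hd p = u \<and> last p = v}"
  by (rule bdd_belowI[of _ 0]) (auto simp: is_path_def intro: path_length_nonneg[OF len_nonneg])

lemma dist_le_path:
  assumes "is_path V E p"
  shows "d (hd p) (last p) \<le> path_length l p"
  unfolding sp_dist_def by (rule cInf_lower[OF _ dist_set_bdd]) (use assms in auto)

lemma dist_greatest:
  assumes "u \<in> V" "v \<in> V" "\<And>p. is_path V E p \<Longrightarrow> hd p = u \<Longrightarrow> last p = v \<Longrightarrow> c \<le> path_length l p"
  shows "c \<le> d u v"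
  unfolding sp_dist_def
  by (rule cInf_greatest) (use assms obtain_path[OF assms(1,2)] in blast)+

lemma dist_nonneg: "u \<in> V \<Longrightarrow> v \<in> V \<Longrightarrow> 0 \<le> d u v"
  by (rule dist_greatest) (auto simp: is_path_def intro: path_length_nonneg[OF len_nonneg])

text \<open>A path to \<open>a\<close> inside \<open>A\<close> and a path from \<open>b\<close>
  outside \<open>A\<close> are disjoint, so they can be glued; conversely
  \<open>path_crossing\<close> cuts every path from \<open>x\<close> to \<open>y\<close> at the
  edge.\<close>

lemma dist_across:
  assumes br: "bridge V E A a b" and x: "x \<in> A" and y: "y \<in> V - A"
  shows "d x y = d x a + l {a, b} + d b y"
proof (rule antisym)
  have V: "x \<in> V" "y \<in> V" "a \<in> V" "b \<in> V" "a \<in> A" "b \<in> V - A" "{a, b} \<in> E"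
    using br x y by (auto simp: bridge_def)
  \<comment> \<open>Two infima stand on the larger side; the terms are rearranged to bound one
    infimum at a time by nested uses of \<open>dist_greatest\<close>.\<close>
  have "d x y - l {a, b} - d b y \<le> d x a"
  proof (rule dist_greatest[OF V(1,3)])
    fix p assume p: "is_path V E p" "hd p = x" "last p = a"
    have "d x y - l {a, b} - path_length l p \<le> d b y"
    proof (rule dist_greatest[OF V(4,2)])
      fix q assume q: "is_path V E q" "hd q = b" "last q = y"
      have "set p \<subseteq> A" using path_crossing[OF p(1) br] p x V by simp
      moreover have "set q \<subseteq> V - A"
        using path_crossing[OF q(1) bridge_commute[OF br]] q y V by simp
      moreover have ne: "p \<noteq> []" "q \<noteq> []" using p q by (auto simp: is_path_def is_walk_def)
      ultimately have "is_path V E (p @ q)"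
        using p q V by (auto simp: is_path_def is_walk_append)
      from dist_le_path[OF this] show "d x y - l {a, b} - path_length l p \<le> path_length l q"
        using ne p q by (simp add: path_length_append)
    qed
    then show "d x y - l {a, b} - d b y \<le> path_length l p" by simp
  qed
  then show "d x y \<le> d x a + l {a, b} + d b y" by simp
  show "d x a + l {a, b} + d b y \<le> d x y"
  proof (rule dist_greatest[OF V(1,2)])
    fix p assume p: "is_path V E p" "hd p = x" "last p = y"
    then obtain q1 q2 where q: "p = q1 @ q2" "q1 \<noteq> []" "q2 \<noteq> []" "last q1 = a" "hd q2 = b"
      using path_crossing[OF p(1) br] x y by auto
    then have "is_path V E q1" "is_path V E q2" "hd q1 = x" "last q2 = y"
      using p by (auto simp: is_path_def is_walk_append)
    with q show "d x a + l {a, b} + d b y \<le> path_length l p"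
      using dist_le_path[of q1] dist_le_path[of q2] by (simp add: path_length_append)
  qed
qed

lemma dist_to_bridge:
  assumes br: "bridge V E A a b" and "x \<in> A"
  shows "d x b = d x a + l {a, b}"
  using dist_across[OF assms, of b] br sp_dist_self[of b V E l] by (auto simp: bridge_def)

text \<open>Without the edge \<open>{a, b}\<close> a walk cannot leave \<open>A\<close>. Conversely
  a path between vertices of \<open>A\<close> stays in \<open>A\<close>, so it avoids
  \<open>b\<close> and with it the deleted edge.\<close>

lemma bridge_side_reachable:
  assumes br: "bridge V E A a b" and x: "x \<in> A"
  shows "{u \<in> V. reachable_in V (E - {{a, b}}) x u} = A"
proof -
  have "u \<in> A" if "is_walk V (E - {{a, b}}) p" "hd p = x" "last p = u" for p u
    using that x
  proof (induction p arbitrary: x)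
    case (Cons y p)
    show ?case
    proof (cases "p = []")
      case False
      then have h: "{y, hd p} \<in> E" "{y, hd p} \<noteq> {a, b}" "is_walk V (E - {{a, b}}) p"
        using Cons.prems(1) by (simp_all add: is_walk_Cons)
      with br Cons.prems have "hd p \<in> A" using edgeD(2)[OF h(1)] by (auto simp: bridge_def)
      then show ?thesis using Cons.IH[OF h(3) refl] False Cons.prems by simp
    qed (use Cons in auto)
  qed (simp add: is_walk_def)
  moreover have "reachable_in V (E - {{a, b}}) x u" if "u \<in> A" for u
  proof -
    have "u \<in> V" "x \<in> V" "b \<notin> A" using br x that by (auto simp: bridge_def)
    then obtain p where p: "is_path V E p" "hd p = x" "last p = u" by (metis obtain_path)
    then have "set p \<subseteq> A" using path_crossing[OF p(1) br] x that by blast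
    have "successively (\<lambda>x y. {x, y} \<in> E - {{a, b}}) p"
    proof (rule successively_mono)
      show "successively (\<lambda>x y. {x, y} \<in> E) p" using p(1) by (simp add: is_path_def is_walk_def)
      fix x y assume "x \<in> set p" "y \<in> set p" "{x, y} \<in> E"
      moreover from this \<open>set p \<subseteq> A\<close> \<open>b \<notin> A\<close> have "x \<noteq> b" "y \<noteq> b" by auto
      ultimately show "{x, y} \<in> E - {{a, b}}" by (simp add: doubleton_eq_iff)
    qed
    then show ?thesis using p by (auto simp: reachable_in_def is_path_def is_walk_def)
  qed
  moreover have "A \<subseteq> V" using br by (simp add: bridge_def)
  ultimately show ?thesis unfolding reachable_in_def by blast
qed

lemma bridge_components:
  assumes br: "bridge V E A a b"
  shows "graph_components V (E - {{a, b}}) = {A, V - A}"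
proof -
  have "{u \<in> V. reachable_in V (E - {{a, b}}) x u} = (if x \<in> A then A else V - A)" if "x \<in> V" for x
    using bridge_side_reachable[OF br, of x] bridge_side_reachable[OF bridge_commute[OF br], of x] that
    by (auto simp: insert_commute)
  moreover have ab: "a \<in> V" "a \<in> A" "b \<in> V" "b \<notin> A" using br by (auto simp: bridge_def)
  ultimately have "graph_components V (E - {{a, b}}) = (\<lambda>x. if x \<in> A then A else V - A) ` V"
    unfolding graph_components_def by (intro image_cong) auto
  with ab show ?thesis by auto
qed

lemma splits_bridge_iff:
  assumes br: "bridge V E A a b"
  shows "splits V E {a, b} V1 V2 \<longleftrightarrow> V1 = A \<and> V2 = V - A \<or> V1 = V - A \<and> V2 = A"
  using br unfolding splits_def bridge_components[OF br] by (auto simp: bridge_def doubleton_eq_iff)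

section \<open>Contracting a tree by pruning leaves\<close>

text \<open>
  \<open>R\<close> is what remains of the tree after pruning leaves, and \<open>c\<close> sends every vertex to the remaining
  vertex into which it has been merged. An edge between different fibres of \<open>c\<close> is an edge of the
  remaining tree.
\<close>

definition contraction :: "'v set \<Rightarrow> ('v \<Rightarrow> 'v) \<Rightarrow> bool" where
  "contraction R c \<longleftrightarrow> R \<subseteq> V \<and> c ` V \<subseteq> R \<and> (\<forall>x\<in>R. c x = x) \<and>
     (\<forall>x y. {x, y} \<in> E \<longrightarrow> c x \<noteq> c y \<longrightarrow> x \<in> R \<and> y \<in> R)"

lemma contractionD:
  assumes "contraction R c"
  shows "R \<subseteq> V" "x \<in> V \<Longrightarrow> c x \<in> R" "x \<in> R \<Longrightarrow> c x = x"
    "{x, y} \<in> E \<Longrightarrow> c x \<noteq> c y \<Longrightarrow> x \<in> R" "{x, y} \<in> E \<Longrightarrow> c x \<noteq> c y \<Longrightarrow> y \<in> R"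
  using assms unfolding contraction_def by blast+

lemma contraction_id: "contraction V (\<lambda>x. x)"
  using edgeD by (auto simp: contraction_def)

text \<open>An edge leaving the fibre of \<open>v\<close> joins different fibres, so it belongs to
  the remaining tree, where \<open>{v, p}\<close> is the only edge at \<open>v\<close>.\<close>

lemma contraction_bridge:
  assumes c: "contraction R c" and v: "v \<in> R" "p \<in> R" "p \<noteq> v"
    and leaf: "{e \<in> E. e \<subseteq> R \<and> v \<in> e} = {{v, p}}"
  shows "bridge V E {x \<in> V. c x = v} v p"
  unfolding bridge_def
proof (intro conjI allI impI)
  show "{v, p} \<in> E" using leaf by blast
  show "v \<in> {x \<in> V. c x = v}" "p \<in> V - {x \<in> V. c x = v}"
    using v contractionD(1,3)[OF c] by auto
  fix x y assume xy: "{x, y} \<in> E" "x \<in> {x \<in> V. c x = v}" "y \<in> V - {x \<in> V. c x = v}"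
  then have R: "x \<in> R" "y \<in> R" using contractionD(4,5)[OF c xy(1)] by auto
  then show "x = v" using xy contractionD(3)[OF c] by auto
  then have "{v, y} \<in> {e \<in> E. e \<subseteq> R \<and> v \<in> e}" using xy R by simp
  then show "y = p" unfolding leaf by (auto simp: doubleton_eq_iff)
qed auto

text \<open>The only edge that drops out of the remaining tree is \<open>{v, p}\<close>, and after
  the merge its ends lie in the same fibre.\<close>

lemma contraction_prune:
  assumes c: "contraction R c" and v: "v \<in> R" "p \<in> R" "p \<noteq> v"
    and leaf: "{e \<in> E. e \<subseteq> R \<and> v \<in> e} = {{v, p}}"
  shows "contraction (R - {v}) (\<lambda>x. if c x = v then p else c x)"
proof -
  have nb: "y = p" if "{v, y} \<in> E" "y \<in> R" for y
  proof -
    have "{v, y} \<in> {e \<in> E. e \<subseteq> R \<and> v \<in> e}" using that v by simp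
    then show ?thesis unfolding leaf by (auto simp: doubleton_eq_iff)
  qed
  have "x \<in> R - {v} \<and> y \<in> R - {v}"
    if "{x, y} \<in> E" "(if c x = v then p else c x) \<noteq> (if c y = v then p else c y)" for x y
  proof -
    have "c x \<noteq> c y" using that(2) by metis
    then have R: "x \<in> R" "y \<in> R" using contractionD(4,5)[OF c that(1)] by simp_all
    then have cxy: "c x = x" "c y = y" using contractionD(3)[OF c] by simp_all
    have "{y, x} \<in> E" using that(1) by (simp add: insert_commute)
    then have "x = v \<Longrightarrow> y = p" "y = v \<Longrightarrow> x = p" using nb that(1) R by blast+
    then show ?thesis using that(2) R v(3) unfolding cxy by (auto split: if_splits)
  qed
  moreover have "R - {v} \<subseteq> V" using contractionD(1)[OF c] by auto
  moreover have "(\<lambda>x. if c x = v then p else c x) ` V \<subseteq> R - {v}"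
    using contractionD(2)[OF c] v by auto
  moreover have "\<forall>x\<in>R - {v}. (if c x = v then p else c x) = x"
    using contractionD(3)[OF c] by auto
  ultimately show ?thesis unfolding contraction_def by blast
qed

text \<open>The last vertex of a longest path starting in \<open>r\<close> is a leaf.\<close>

lemma contraction_leaf:
  assumes c: "contraction R c" and r: "r \<in> R" "R \<noteq> {r}"
  shows "\<exists>v p. v \<in> R \<and> p \<in> R \<and> p \<noteq> v \<and> v \<noteq> r \<and> {e \<in> E. e \<subseteq> R \<and> v \<in> e} = {{v, p}}"
proof -
  have RV: "R \<subseteq> V" using c by (simp add: contraction_def)
  \<comment> \<open>A walk from \<open>r\<close> to another remaining vertex must leave the fibre of
    \<open>r\<close>; the edge by which it does so is an edge of the remaining tree, hence starts at
    \<open>r\<close> itself.\<close>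
  have "\<exists>z\<in>R. {r, z} \<in> E"
  proof -
    obtain y where y: "y \<in> R" "y \<noteq> r" using r by auto
    obtain p where p: "is_path V E p" "hd p = r" "last p = y"
      using obtain_path[of r y] y r RV by blast
    have "\<exists>a b. {a, b} \<in> E \<and> c a = r \<and> c b \<noteq> r"
      if "is_walk V E p" "c (hd p) = r" "c (last p) \<noteq> r" for p
      using that
    proof (induction p)
      case (Cons a p)
      then show ?case by (cases "c (hd p) = r") (auto simp: is_walk_Cons split: if_splits)
    qed (simp add: is_walk_def)
    moreover have "c r = r" "c y = y" using contractionD(3)[OF c] y r by auto
    ultimately obtain a b where "{a, b} \<in> E" "c a = r" "c b \<noteq> r"
      using p y by (metis is_path_def)
    moreover from this have "a \<in> R" "b \<in> R" using contractionD(4,5)[OF c] by metis+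
    moreover from calculation have "a = r" using contractionD(3)[OF c] by simp
    ultimately show ?thesis by auto
  qed
  then obtain z where z: "z \<in> R" "{r, z} \<in> E" by blast
  define Q where "Q = {q. is_path V E q \<and> set q \<subseteq> R \<and> hd q = r}"
  have "Q \<subseteq> {q. set q \<subseteq> V \<and> distinct q}" by (auto simp: Q_def is_path_def is_walk_def)
  then have fQ: "finite Q" using finite_subset_distinct[OF finite_V] finite_subset by blast
  have rz: "[r, z] \<in> Q"
    using z r RV edgeD[OF z(2)] by (auto simp: Q_def is_path_def is_walk_def)
  with fQ have "Max (length ` Q) \<in> length ` Q" by (intro Max_in) auto
  then obtain q where q: "q \<in> Q" "length q = Max (length ` Q)" by auto
  have max: "length q' \<le> length q" if "q' \<in> Q" for q'
    unfolding q(2) using that fQ by (intro Max_ge) auto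
  \<comment> \<open>Thanks to \<open>z\<close> the end \<open>u\<close> of the longest path has a
    predecessor \<open>y\<close> and differs from \<open>r\<close>.\<close>
  have "2 \<le> length q" using max[OF rz] by simp
  then obtain u y q1 where "rev q = u # y # q1"
    by (cases "rev q"; cases "tl (rev q)") auto
  then have qd: "q = rev q1 @ [y, u]" by (simp add: rev_swap)
  define q0 where "q0 = rev q1"
  note qd = qd[folded q0_def]
  have pq: "is_path V E q" "set q \<subseteq> R" "hd q = r" using q(1) by (auto simp: Q_def)
  have dq: "distinct q" and yu: "{y, u} \<in> E" and uy: "u \<noteq> y" "u \<in> R" "y \<in> R" "u \<noteq> r"
    using pq unfolding qd
    by (auto simp: is_path_def is_walk_def successively_append_iff hd_append split: if_splits)
  have "x = y" if x: "{u, x} \<in> E" "x \<in> R" for x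
  proof (rule ccontr)
    \<comment> \<open>A second neighbour of \<open>u\<close> either prolongs the longest path or,
      lying on it before \<open>y\<close>, closes a cycle.\<close>
    assume "x \<noteq> y"
    have "x \<noteq> u" "x \<in> V" using edgeD[OF x(1)] by auto
    show False
    proof (cases "x \<in> set q")
      case False
      then have "q @ [x] \<in> Q" using pq x \<open>x \<in> V\<close>
        by (auto simp: Q_def is_path_def is_walk_append is_walk_Cons qd hd_append)
      from max[OF this] show False by simp
    next
      case True
      then have "x \<in> set q0" using \<open>x \<noteq> u\<close> \<open>x \<noteq> y\<close> by (auto simp: qd)
      then obtain q1 q2 where q0: "q0 = q1 @ x # q2" by (meson split_list)
      have "is_path V E (x # q2 @ [y, u])"
        using pq(1) unfolding qd q0
        by (cases "q1 = []") (auto simp: is_path_def is_walk_append)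
      then have "is_cycle V E (x # q2 @ [y, u])" using x by (simp add: is_cycle_def)
      then show False using tree by (auto simp: is_tree_def)
    qed
  qed
  moreover have "\<exists>x. e = {u, x}" if "e \<in> E" "u \<in> e" for e
    using edgeE[OF that(1)] that(2) by (metis doubleton_eq_iff insertE singletonD)
  moreover have "{u, y} \<in> E" using yu by (simp add: insert_commute)
  ultimately have "{e \<in> E. e \<subseteq> R \<and> u \<in> e} = {{u, y}}"
    using uy by fast
  with uy show ?thesis by blast
qed

lemma edges_after_prune:
  assumes "{e \<in> E. e \<subseteq> R \<and> v \<in> e} = {{v, p}}"
  shows "{e \<in> E. e \<subseteq> R} = insert {v, p} {e \<in> E. e \<subseteq> R - {v}}"
  using assms by blast

text \<open>A pruning removes one vertex and one edge, and a single vertex has no edge. The program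
  is given \<open>n\<close> but not the number of edges, so its loop bounds depend on this
  count.\<close>

lemma card_contraction_edges:
  assumes "contraction R c" "r \<in> R"
  shows "card {e \<in> E. e \<subseteq> R} = card R - 1"
  using assms
proof (induction "card R" arbitrary: R c)
  case 0
  then show ?case using finite_V finite_subset by (fastforce simp: contraction_def)
next
  case (Suc k)
  have fin: "finite R" using Suc.prems finite_V finite_subset by (auto simp: contraction_def)
  show ?case
  proof (cases "R = {r}")
    case True
    have "{e \<in> E. e \<subseteq> {r}} = {}" by (auto elim!: edgeE)
    then show ?thesis using True by simp
  next
    case False
    then obtain v p where v: "v \<in> R" "p \<in> R" "p \<noteq> v" "v \<noteq> r"
      and leaf: "{e \<in> E. e \<subseteq> R \<and> v \<in> e} = {{v, p}}"
      using contraction_leaf[OF Suc.prems] by blast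
    have "card {e \<in> E. e \<subseteq> R - {v}} = card (R - {v}) - 1"
      using Suc.hyps(2) v Suc.prems(2) fin
      by (intro Suc.hyps(1)[OF _ contraction_prune[OF Suc.prems(1) v(1-3) leaf]]) auto
    moreover have "card (insert {v, p} {e \<in> E. e \<subseteq> R - {v}}) = Suc (card {e \<in> E. e \<subseteq> R - {v}})"
      using finite_E by (intro card_insert_disjoint) auto
    moreover have "card (R - {v}) \<ge> 1" using v fin by (metis One_nat_def Suc_leI card_gt_0_iff
      Diff_iff empty_iff finite_Diff singletonD)
    ultimately show ?thesis using v fin by (simp add: edges_after_prune[OF leaf] card_Diff_singleton)
  qed
qed

lemma card_edges: "card E = card V - 1"
proof -
  obtain r where "r \<in> V" using tree by (auto simp: is_tree_def)
  moreover have "{e \<in> E. e \<subseteq> V} = E" using edge_subset by blast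
  ultimately show ?thesis using card_contraction_edges[OF contraction_id] by auto
qed

end

section \<open>Summaries of vertex sets\<close>

text \<open>
  The components are the total weight, the total of \<open>w v * t v\<close>, the weighted sum of distances, the
  maximal distance and a vertex attaining it.
\<close>

type_synonym 'v summary = "real \<times> real \<times> real \<times> real \<times> 'v"

fun join :: "'v summary \<Rightarrow> 'v summary \<Rightarrow> 'v summary" where
  "join (W, Z, S, H, F) (W', Z', S', H', F') =
     (W + W', Z + Z', S + S', if H < H' then H' else H, if H < H' then F' else F)"

fun shift :: "real \<Rightarrow> 'v summary \<Rightarrow> 'v summary" where
  "shift c (W, Z, S, H, F) = (W, Z, S + W * c, H + c, F)"

fun edge_value :: "real \<Rightarrow> real \<Rightarrow> 'v summary \<Rightarrow> 'v summary \<Rightarrow> real" where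
  "edge_value lam c (W, Z, S, H, F) (W', Z', S', H', F') =
     lam * ((S + W * (c + H')) + (S' + W' * (c + H))) - (1 - lam) * \<bar>Z - Z'\<bar>"

fun farthest :: "'v summary \<Rightarrow> 'v" where
  "farthest (W, Z, S, H, F) = F"

text \<open>A history lists the pruned leaves, each with the neighbour into which it is merged, in order.\<close>

definition rep :: "('v \<times> 'v) list \<Rightarrow> 'v \<Rightarrow> 'v" where
  "rep h x = foldl (\<lambda>u (v, p). if u = v then p else u) x h"

lemma rep_Nil [simp]: "rep [] x = x"
  by (simp add: rep_def)

lemma rep_snoc [simp]: "rep (h @ [(v, p)]) x = (if rep h x = v then p else rep h x)"
  by (simp add: rep_def)

locale maxian_tree = weighted_tree V E l
  for V :: "'v set" and E :: "'v set set" and l :: "'v set \<Rightarrow> real" +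
  fixes w t :: "'v \<Rightarrow> real" and lam :: real
  assumes w_nonneg: "\<And>v. v \<in> V \<Longrightarrow> 0 \<le> w v" and lam_nonneg: "0 \<le> lam"
begin

text \<open>
  The distance \<open>-1\<close> of the empty set is below every real distance, so that \<open>join\<close> never selects
  the meaningless farthest vertex of an empty set.
\<close>

fun summarises :: "'v summary \<Rightarrow> 'v set \<Rightarrow> 'v \<Rightarrow> bool" where
  "summarises (W, Z, S, H, F) X u \<longleftrightarrow>
     W = (\<Sum>x\<in>X. w x) \<and> Z = (\<Sum>x\<in>X. w x * t x) \<and> S = (\<Sum>x\<in>X. w x * d x u) \<and>
     (if X = {} then H = -1 else F \<in> X \<and> H = d F u \<and> (\<forall>x\<in>X. d x u \<le> H))"

lemma summarises_singleton: "v \<in> V \<Longrightarrow> summarises (w v, w v * t v, 0, 0, v) {v} v"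
  by (simp add: sp_dist_self)

lemma summarises_join:
  assumes "summarises m X u" "summarises m' Y u" "X \<subseteq> V" "Y \<subseteq> V" "X \<inter> Y = {}" "u \<in> V"
  shows "summarises (join m m') (X \<union> Y) u"
proof -
  obtain W Z S H F W' Z' S' H' F' where m: "m = (W, Z, S, H, F)" "m' = (W', Z', S', H', F')"
    by (metis prod_cases5)
  have fin: "finite X" "finite Y" using assms(3,4) finite_V finite_subset by auto
  have nonneg: "0 \<le> d x u" if "x \<in> X \<union> Y" for x
    using that assms(3,4,6) dist_nonneg by blast
  have a: "X = {} \<Longrightarrow> H = -1" "X \<noteq> {} \<Longrightarrow> F \<in> X \<and> H = d F u"
    "\<And>x. x \<in> X \<Longrightarrow> d x u \<le> H"
    and b: "Y = {} \<Longrightarrow> H' = -1" "Y \<noteq> {} \<Longrightarrow> F' \<in> Y \<and> H' = d F' u"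
    "\<And>x. x \<in> Y \<Longrightarrow> d x u \<le> H'"
    using assms(1,2) unfolding m by (auto split: if_splits)
  have sums: "W + W' = (\<Sum>x\<in>X \<union> Y. w x)" "Z + Z' = (\<Sum>x\<in>X \<union> Y. w x * t x)"
    "S + S' = (\<Sum>x\<in>X \<union> Y. w x * d x u)"
    using assms(1,2) unfolding m by (simp_all add: sum.union_disjoint[OF fin assms(5)])
  show ?thesis
  proof (cases "H < H'")
    case True
    have "Y \<noteq> {}"
    proof
      assume "Y = {}"
      with True b(1) have "H < -1" by simp
      then show False using a(1) a(2) nonneg[of F] by (cases "X = {}") auto
    qed
    moreover have "d x u \<le> H'" if "x \<in> X \<union> Y" for x
      using that a(3)[of x] b(3)[of x] True by auto
    ultimately show ?thesis using b(2) True sums by (simp add: m)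
  next
    case False
    have "X \<noteq> {}" if "Y \<noteq> {}"
    proof
      assume "X = {}"
      with False a(1) have "H' \<le> -1" by simp
      then show False using b(2)[OF that] nonneg[of F'] by auto
    qed
    moreover have "d x u \<le> H" if "x \<in> X \<union> Y" for x
      using that a(3)[of x] b(3)[of x] False by auto
    ultimately show ?thesis using a(1,2) False sums by (cases "X = {}") (auto simp: m)
  qed
qed

text \<open>All vertices of \<open>X\<close> reach \<open>b\<close> through the edge, so their
  distances grow by the same amount. An empty \<open>X\<close> is excluded because
  \<open>shift\<close> could destroy the distance \<open>-1\<close> that marks it; the program never
  shifts an empty summary.\<close>

lemma summarises_shift:
  assumes m: "summarises m X a" and br: "bridge V E A a b" and X: "X \<subseteq> A" "X \<noteq> {}"
  shows "summarises (shift (l {a, b}) m) X b"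
proof -
  obtain W Z S H F where m': "m = (W, Z, S, H, F)" by (metis prod_cases5)
  have *: "d x b = d x a + l {a, b}" if "x \<in> X" for x
    using dist_to_bridge[OF br] X that by auto
  then have "(\<Sum>x\<in>X. w x * d x b) = (\<Sum>x\<in>X. w x * d x a) + (\<Sum>x\<in>X. w x) * l {a, b}"
    by (simp add: distrib_left sum.distrib sum_distrib_right cong: sum.cong)
  then show ?thesis using m * X unfolding m' by auto
qed

lemma served_cost:
  assumes m: "summarises (W, Z, S, H, F) A a" and br: "bridge V E A a b" and x: "x \<in> V - A"
  shows "(\<Sum>v\<in>A. w v * d v x) = S + W * (l {a, b} + d x b)"
proof -
  have "d v x = d v a + (l {a, b} + d x b)" if "v \<in> A" for v
    using dist_across[OF br that x] sp_dist_commute[of V E l b x] by simp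
  then have "(\<Sum>v\<in>A. w v * d v x) = (\<Sum>v\<in>A. w v * d v a) + (\<Sum>v\<in>A. w v) * (l {a, b} + d x b)"
    by (simp only: distrib_left sum.distrib sum_distrib_right cong: sum.cong)
  with m show ?thesis by simp
qed

text \<open>For a fixed edge the objective is a constant plus one term per facility, nondecreasing
  in the distance of the facility from its end of the edge because \<open>W\<close>,
  \<open>W'\<close> and \<open>lam\<close> are nonnegative. \<open>x1\<close> lies opposite to
  \<open>A\<close>, hence comes from \<open>m'\<close>.\<close>

lemma edge_optimum:
  assumes m: "summarises m A a" and m': "summarises m' (V - A) b" and br: "bridge V E A a b"
  defines "sol \<equiv> ({a, b}, A, V - A, farthest m', farthest m)"
  shows "feasible V E sol" "f_pmax V E l w t lam sol = edge_value lam (l {a, b}) m m'"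
    "feasible V E ({a, b}, V1, V2, x1, x2) \<Longrightarrow>
       f_pmax V E l w t lam ({a, b}, V1, V2, x1, x2) \<le> edge_value lam (l {a, b}) m m'"
proof -
  obtain W Z S H F W' Z' S' H' F' where mm: "m = (W, Z, S, H, F)" "m' = (W', Z', S', H', F')"
    by (metis prod_cases5)
  have ne: "A \<noteq> {}" "V - A \<noteq> {}" "A \<subseteq> V" using br by (auto simp: bridge_def)
  have F: "F \<in> A" "F' \<in> V - A" and H: "H = d F a" "H' = d F' b"
    and max: "\<And>x. x \<in> A \<Longrightarrow> d x a \<le> H" "\<And>x. x \<in> V - A \<Longrightarrow> d x b \<le> H'"
    and Z: "Z = (\<Sum>x\<in>A. w x * t x)" "Z' = (\<Sum>x\<in>V - A. w x * t x)"
    and W: "W = (\<Sum>x\<in>A. w x)" "W' = (\<Sum>x\<in>V - A. w x)"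
    using m m' ne unfolding mm by auto
  have W_nonneg: "0 \<le> W" "0 \<le> W'"
    unfolding W using ne(3) w_nonneg by (auto intro!: sum_nonneg)
  have cost: "(\<Sum>v\<in>A. w v * d v x) = S + W * (l {a, b} + d x b)" if "x \<in> V - A" for x
    using served_cost[OF m[unfolded mm] br that] .
  have cost': "(\<Sum>v\<in>V - A. w v * d v x) = S' + W' * (l {a, b} + d x a)" if "x \<in> A" for x
    using served_cost[OF m'[unfolded mm] bridge_commute[OF br], of x] that ne(3)
    by (auto simp: insert_commute)
  show "feasible V E sol" "f_pmax V E l w t lam sol = edge_value lam (l {a, b}) m m'"
    using F by (simp_all add: sol_def mm splits_bridge_iff[OF br] cost cost' H Z)
  have bound: "f_pmax V E l w t lam ({a, b}, A, V - A, x1, x2) \<le> edge_value lam (l {a, b}) m m'"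
    if "x1 \<in> V - A" "x2 \<in> A" for x1 x2
    using that W_nonneg lam_nonneg max
    by (auto simp: mm cost cost' Z intro!: mult_left_mono add_mono)
  assume f: "feasible V E ({a, b}, V1, V2, x1, x2)"
  \<comment> \<open>Swapping the sides together with the facilities leaves the objective unchanged,
    which reduces the claim to \<open>V1 = A\<close>.\<close>
  have swap: "f_pmax V E l w t lam ({a, b}, V1, V2, x1, x2) =
      f_pmax V E l w t lam ({a, b}, V2, V1, x2, x1)"
    by (simp add: abs_minus_commute add.commute)
  show "f_pmax V E l w t lam ({a, b}, V1, V2, x1, x2) \<le> edge_value lam (l {a, b}) m m'"
    using f bound unfolding feasible.simps splits_bridge_iff[OF br] by (metis swap)
qed

section \<open>Pruning histories and the update of summaries\<close>

definition remaining :: "('v \<times> 'v) list \<Rightarrow> 'v set" where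
  "remaining h = V - fst ` set h"

definition cluster :: "('v \<times> 'v) list \<Rightarrow> 'v \<Rightarrow> 'v set" where
  "cluster h u = {x \<in> V. rep h x = u}"

text \<open>Histories grow at the end because the program appends each pruning to its arrays. The
  order is left open, so the results below do not depend on how leaves are found; protecting
  \<open>r\<close> fixes the vertex that is left at the end.\<close>

inductive pruning :: "'v \<Rightarrow> ('v \<times> 'v) list \<Rightarrow> bool" for r where
  Nil: "pruning r []"
| Snoc: "pruning r h \<Longrightarrow> v \<in> remaining h \<Longrightarrow> p \<in> remaining h \<Longrightarrow> p \<noteq> v \<Longrightarrow> v \<noteq> r \<Longrightarrow>
    {e \<in> E. e \<subseteq> remaining h \<and> v \<in> e} = {{v, p}} \<Longrightarrow> pruning r (h @ [(v, p)])"

lemma remaining_snoc [simp]: "remaining (h @ [(v, p)]) = remaining h - {v}"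
  by (auto simp: remaining_def)

lemma pruning_snocD:
  assumes "pruning r (h @ [(v, p)])"
  shows "pruning r h" "v \<in> remaining h" "p \<in> remaining h" "p \<noteq> v" "v \<noteq> r"
    "{e \<in> E. e \<subseteq> remaining h \<and> v \<in> e} = {{v, p}}"
  by (rule pruning.cases[OF assms]; simp)+

lemma pruning_contraction: "pruning r h \<Longrightarrow> contraction (remaining h) (rep h)"
proof (induction rule: pruning.induct)
  case Nil
  then show ?case using contraction_id by (simp add: remaining_def)
next
  case (Snoc h v p)
  from contraction_prune[OF Snoc.IH Snoc.hyps(2-4,6)] show ?case by simp
qed

lemma pruning_root: "pruning r h \<Longrightarrow> r \<in> V \<Longrightarrow> r \<in> remaining h"
  by (induction rule: pruning.induct) (auto simp: remaining_def)

text \<open>A pruning takes only the edge it records out of the remaining tree. This makes an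
  optimum over the recorded edges an optimum over all edges.\<close>

lemma pruning_edges:
  "pruning r h \<Longrightarrow> e \<in> E \<Longrightarrow> e \<subseteq> remaining h \<or> (\<exists>(v, p)\<in>set h. e = {v, p})"
proof (induction rule: pruning.induct)
  case Nil
  then show ?case using edge_subset by (simp add: remaining_def)
next
  case (Snoc h v p)
  have "e = {v, p} \<or> e \<subseteq> remaining h - {v}" if "e \<subseteq> remaining h"
    using edges_after_prune[OF Snoc.hyps(6)] that Snoc.prems by blast
  then show ?case using Snoc.IH[OF Snoc.prems] by auto
qed

lemma card_remaining: "pruning r h \<Longrightarrow> card (remaining h) + length h = card V"
proof (induction rule: pruning.induct)
  case (Snoc h v p)
  have "finite (remaining h)" using finite_V by (simp add: remaining_def)
  with Snoc show ?case using card_Suc_Diff1[of "remaining h" v] by simp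
qed (simp add: remaining_def)

lemma pruning_leaf:
  assumes "pruning r h" "r \<in> V" "Suc (length h) < card V"
  shows "\<exists>v p. v \<in> remaining h \<and> p \<in> remaining h \<and> p \<noteq> v \<and> v \<noteq> r \<and>
    {e \<in> E. e \<subseteq> remaining h \<and> v \<in> e} = {{v, p}}"
proof (rule contraction_leaf[OF pruning_contraction[OF assms(1)] pruning_root[OF assms(1,2)]])
  show "remaining h \<noteq> {r}" using card_remaining[OF assms(1)] assms(3) by auto
qed

lemma pruning_complete:
  assumes "pruning r h" "r \<in> V" "Suc (length h) = card V"
  shows "remaining h = {r}" "e \<in> E \<Longrightarrow> \<exists>(v, p)\<in>set h. e = {v, p}"
proof -
  have "card (remaining h) = 1" using card_remaining[OF assms(1)] assms(3) by simp
  with pruning_root[OF assms(1,2)] show rem: "remaining h = {r}"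
    by (auto simp: card_1_singleton_iff)
  assume e: "e \<in> E"
  have "\<not> e \<subseteq> {r}" by (rule edgeE[OF e]) auto
  with pruning_edges[OF assms(1) e] rem show "\<exists>(v, p)\<in>set h. e = {v, p}" by simp
qed

lemma cluster_Nil: "v \<in> V \<Longrightarrow> cluster [] v = {v}"
  by (auto simp: cluster_def)

lemma cluster_snoc:
  "p \<noteq> v \<Longrightarrow> cluster (h @ [(v, p)]) u =
     (if u = v then {} else if u = p then cluster h p \<union> cluster h v else cluster h u)"
  by (auto simp: cluster_def)

lemma cluster_root:
  assumes "pruning r h" "r \<in> V" "Suc (length h) = card V"
  shows "cluster h r = V"
  using contractionD(2)[OF pruning_contraction[OF assms(1)]] pruning_complete(1)[OF assms]
  by (auto simp: cluster_def)

text \<open>Here the clusters meet the problem: the summary of \<open>v\<close> at the moment of its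
  pruning describes one whole side of the edge \<open>{v, p}\<close>.\<close>

lemma pruning_bridge:
  assumes "pruning r (h @ [(v, p)])"
  shows "bridge V E (cluster h v) v p"
  unfolding cluster_def
  by (rule contraction_bridge[OF pruning_contraction]) (use pruning_snocD[OF assms] in auto)

text \<open>Only the entry of \<open>p\<close> changes. That of \<open>v\<close> is left alone and
  keeps the summary of the side of \<open>v\<close> for the backward pass.\<close>

lemma summarises_prune:
  assumes pr: "pruning r (h @ [(v, p)])"
    and A: "\<And>u. u \<in> remaining h \<Longrightarrow> summarises (A u) (cluster h u) u"
    and u: "u \<in> remaining (h @ [(v, p)])"
  shows "summarises (if u = p then join (A p) (shift (l {v, p}) (A v)) else A u)
    (cluster (h @ [(v, p)]) u) u"
proof (cases "u = p")
  case True
  note D = pruning_snocD[OF pr] and br = pruning_bridge[OF pr]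
  have "v \<in> cluster h v" "p \<in> V" using br by (auto simp: bridge_def)
  then have "summarises (shift (l {v, p}) (A v)) (cluster h v) p"
    using summarises_shift[OF A[OF D(2)] br] by auto
  moreover have "cluster h p \<inter> cluster h v = {}" using D(4) by (auto simp: cluster_def)
  ultimately have "summarises (join (A p) (shift (l {v, p}) (A v))) (cluster h p \<union> cluster h v) p"
    using A[OF D(3)] \<open>p \<in> V\<close> by (intro summarises_join) (auto simp: cluster_def)
  then show ?thesis using True D(4) by (simp add: cluster_snoc)
next
  case False
  then show ?thesis using A[of u] u pruning_snocD(4)[OF pr] by (simp add: cluster_snoc)
qed

text \<open>What lies outside the cluster of \<open>v\<close> is the cluster of \<open>p\<close>
  before the merge together with what lies outside the merged cluster.\<close>

lemma summarises_outside:
  assumes pr: "pruning r (h @ [(v, p)])"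
    and p: "summarises m (cluster h p) p"
    and B: "summarises b (V - cluster (h @ [(v, p)]) p) p"
  shows "summarises (join m b) (V - cluster h v) p"
proof -
  have "p \<noteq> v" by (rule pruning_snocD[OF pr])
  then have eq: "V - cluster h v = cluster h p \<union> (V - cluster (h @ [(v, p)]) p)"
    and disj: "cluster h p \<inter> (V - cluster (h @ [(v, p)]) p) = {}"
    by (auto simp: cluster_snoc) (auto simp: cluster_def)
  have "p \<in> V" using pruning_bridge[OF pr] by (auto simp: bridge_def)
  then show ?thesis unfolding eq
    by (intro summarises_join p B disj) (auto simp: cluster_def)
qed

text \<open>Undoing a pruning splits one cluster into two. The complement of the cluster of
  \<open>v\<close> is seen from \<open>p\<close> and shifted to \<open>v\<close>, while the
  complement at \<open>p\<close> gains the cluster of \<open>v\<close>; both use the old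
  \<open>B p\<close>.\<close>

lemma summarises_unprune:
  assumes pr: "pruning r (h @ [(v, p)])"
    and v: "summarises a (cluster h v) v" and p: "summarises m (cluster h p) p"
    and B: "\<And>u. u \<in> remaining (h @ [(v, p)]) \<Longrightarrow>
      summarises (B u) (V - cluster (h @ [(v, p)]) u) u"
    and u: "u \<in> remaining h"
  shows "summarises (if u = v then shift (l {v, p}) (join m (B p))
    else if u = p then join (B p) (shift (l {v, p}) a) else B u) (V - cluster h u) u"
proof -
  note D = pruning_snocD[OF pr] and br = pruning_bridge[OF pr]
  have V: "v \<in> cluster h v" "p \<in> V - cluster h v" "p \<in> V" "cluster h v \<subseteq> V"
    using br by (auto simp: bridge_def)
  have Bp: "summarises (B p) (V - cluster (h @ [(v, p)]) p) p" using B[of p] D by simp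
  have "summarises (shift (l {p, v}) (join m (B p))) (V - cluster h v) v"
    by (rule summarises_shift[OF summarises_outside[OF pr p Bp] bridge_commute[OF br]])
      (use V in auto)
  moreover have "summarises (join (B p) (shift (l {v, p}) a)) (V - cluster h p) p"
  proof -
    have "V - cluster h p = (V - cluster (h @ [(v, p)]) p) \<union> cluster h v"
      using D(4) V(4) by (auto simp: cluster_snoc) (auto simp: cluster_def)
    moreover have "summarises (shift (l {v, p}) a) (cluster h v) p"
      by (rule summarises_shift[OF v br]) (use V in auto)
    ultimately show ?thesis
      using Bp V D(4) by (auto simp: cluster_snoc intro!: summarises_join)
  qed
  moreover have "summarises (B u) (V - cluster h u) u" if "u \<noteq> v" "u \<noteq> p"
    using B[of u] that u D(4) by (simp add: cluster_snoc)
  ultimately show ?thesis by (auto simp: insert_commute)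
qed

end

section \<open>Cost-bounded execution\<close>

fun loopfree :: "com \<Rightarrow> bool" where
  "loopfree (Seq a b) \<longleftrightarrow> loopfree a \<and> loopfree b"
| "loopfree (Cond _ a b) \<longleftrightarrow> loopfree a \<and> loopfree b"
| "loopfree (While _ _) \<longleftrightarrow> False"
| "loopfree _ \<longleftrightarrow> True"

text \<open>The value at a loop is junk: \<open>run\<close> is applied to loop-free programs only.\<close>

fun run :: "com \<Rightarrow> state \<Rightarrow> state" where
  "run Skip s = s"
| "run (NAssign x a) s = s\<lparr>nvar := (nvar s)(x := nval a s)\<rparr>"
| "run (RAssign x a) s = s\<lparr>rvar := (rvar s)(x := rval a s)\<rparr>"
| "run (NStore x i a) s = s\<lparr>narr := (narr s)(x := (narr s x)(nval i s := nval a s))\<rparr>"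
| "run (RStore x i a) s = s\<lparr>rarr := (rarr s)(x := (rarr s x)(nval i s := rval a s))\<rparr>"
| "run (Seq a b) s = run b (run a s)"
| "run (Cond b c1 c2) s = (if bval b s then run c1 s else run c2 s)"
| "run (While _ _) s = s"

text \<open>The branches of a conditional are added instead of maximised: any constant will do, and
  those of the loop bodies are never evaluated.\<close>

fun maxcost :: "com \<Rightarrow> nat" where
  "maxcost (NAssign x a) = 1 + ncost a"
| "maxcost (RAssign x a) = 1 + rcost a"
| "maxcost (NStore x i a) = 1 + ncost i + ncost a"
| "maxcost (RStore x i a) = 1 + ncost i + rcost a"
| "maxcost (Seq a b) = maxcost a + maxcost b"
| "maxcost (Cond b c1 c2) = 1 + bcost b + maxcost c1 + maxcost c2"
| "maxcost _ = 1"

definition runs :: "com \<Rightarrow> state \<Rightarrow> nat \<Rightarrow> (state \<Rightarrow> bool) \<Rightarrow> bool" where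
  "runs c s K Q \<longleftrightarrow> (\<exists>k s'. exec c s k s' \<and> k \<le> K \<and> Q s')"

lemma runs_run: "loopfree c \<Longrightarrow> runs c s (maxcost c) (\<lambda>s'. s' = run c s)"
proof (induction c arbitrary: s)
  case (Seq c1 c2)
  then obtain k1 k2 where "exec c1 s k1 (run c1 s)" "k1 \<le> maxcost c1"
      "exec c2 (run c1 s) k2 (run c2 (run c1 s))" "k2 \<le> maxcost c2"
    unfolding runs_def by force
  then show ?case
    unfolding runs_def by (intro exI[of _ "k1 + k2"] exI conjI) (auto intro: exec.Seq)
next
  case (Cond b c1 c2)
  then obtain k1 k2 where "exec c1 s k1 (run c1 s)" "k1 \<le> maxcost c1"
      "exec c2 s k2 (run c2 s)" "k2 \<le> maxcost c2"
    unfolding runs_def by force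
  then show ?case
    unfolding runs_def
    by (intro exI[of _ "1 + bcost b + (if bval b s then k1 else k2)"] exI conjI)
      (auto simp del: One_nat_def plus_1_eq_Suc simp: exec.CondTrue exec.CondFalse)
next
  case (NAssign x a)
  show ?case unfolding runs_def by (intro exI conjI, rule exec.NAssign) simp_all
next
  case (RAssign x a)
  show ?case unfolding runs_def by (intro exI conjI, rule exec.RAssign) simp_all
next
  case (NStore x i a)
  show ?case unfolding runs_def by (intro exI conjI, rule exec.NStore) simp_all
next
  case (RStore x i a)
  show ?case unfolding runs_def by (intro exI conjI, rule exec.RStore) simp_all
next
  case Skip
  show ?case unfolding runs_def by (intro exI conjI, rule exec.Skip) simp_all
qed simp

lemma runs_mono:
  "runs c s K P \<Longrightarrow> K \<le> K' \<Longrightarrow> (\<And>s'. P s' \<Longrightarrow> Q s') \<Longrightarrow> runs c s K' Q"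
  unfolding runs_def by (meson order_trans)

lemma runs_Seq:
  assumes "runs c1 s K1 P" "\<And>s'. P s' \<Longrightarrow> runs c2 s' K2 Q"
  shows "runs (Seq c1 c2) s (K1 + K2) Q"
proof -
  obtain k1 s1 where 1: "exec c1 s k1 s1" "k1 \<le> K1" "P s1" using assms(1) by (auto simp: runs_def)
  obtain k2 s2 where 2: "exec c2 s1 k2 s2" "k2 \<le> K2" "Q s2"
    using assms(2)[OF 1(3)] by (auto simp: runs_def)
  show ?thesis
    unfolding runs_def using exec.Seq[OF 1(1) 2(1)] 1 2 by (intro exI conjI) auto
qed

text \<open>The measure bounds the number of iterations and \<open>Suc\<close> pays for the final
  test. A loop-free body has a computable final state and a constant cost bound, so users of this
  rule need not reason about \<open>exec\<close>.\<close>

lemma runs_While: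
  assumes c: "loopfree c"
    and step: "\<And>s. I s \<Longrightarrow> bval b s \<Longrightarrow> I (run c s) \<and> m (run c s) < m s"
    and I: "I s"
  shows "runs (While b c) s ((1 + bcost b + maxcost c) * Suc (m s)) (\<lambda>s'. I s' \<and> \<not> bval b s')"
  using I
proof (induction "m s" arbitrary: s rule: less_induct)
  case less
  show ?case
  proof (cases "bval b s")
    case False
    then show ?thesis unfolding runs_def
      by (intro exI[of _ "1 + bcost b"] exI[of _ s] conjI exec.WhileFalse) (use less.prems in auto)
  next
    case True
    note st = step[OF less.prems True]
    obtain k1 where 1: "exec c s k1 (run c s)" "k1 \<le> maxcost c"
      using runs_run[OF c] by (auto simp: runs_def)
    obtain k2 s2 where 2: "exec (While b c) (run c s) k2 s2"
      "k2 \<le> (1 + bcost b + maxcost c) * Suc (m (run c s))" "I s2 \<and> \<not> bval b s2"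
      using less.hyps[of "run c s"] st by (auto simp: runs_def)
    have "(1 + bcost b + maxcost c) * Suc (m (run c s)) \<le> (1 + bcost b + maxcost c) * m s"
      using st by (intro mult_left_mono) auto
    then have "1 + bcost b + k1 + k2 \<le> (1 + bcost b + maxcost c) * Suc (m s)"
      using 1(2) 2(2) by simp
    with exec.WhileTrue[OF True 1(1) 2(1)] 2(3) show ?thesis unfolding runs_def by blast
  qed
qed

definition block :: "com list \<Rightarrow> com" where
  "block cs = foldr Seq cs Skip"

lemma block_simps [simp]:
  "loopfree (block []) = True" "loopfree (block (c # cs)) \<longleftrightarrow> loopfree c \<and> loopfree (block cs)"
  "run (block []) s = s" "run (block (c # cs)) s = run (block cs) (run c s)"
  by (simp_all add: block_def)

text \<open>
  Record updates mention the state twice, so unfolding \<open>run\<close> along a block would grow exponentially;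
  the rules below describe the components of the final state instead.
\<close>

declare run.simps [simp del]
declare run.simps(1,6) [simp]

lemma run_Cond [simp]: "run (Cond b c1 c2) s = (if bval b s then run c1 s else run c2 s)"
  by (simp add: run.simps)

lemma run_basic [simp]:
  "nvar (run (NAssign x a) s) = (nvar s)(x := nval a s)"
  "narr (run (NAssign x a) s) = narr s"
  "rvar (run (NAssign x a) s) = rvar s"
  "rarr (run (NAssign x a) s) = rarr s"
  "nvar (run (RAssign x b) s) = nvar s"
  "narr (run (RAssign x b) s) = narr s"
  "rvar (run (RAssign x b) s) = (rvar s)(x := rval b s)"
  "rarr (run (RAssign x b) s) = rarr s"
  "nvar (run (NStore x i a) s) = nvar s"
  "narr (run (NStore x i a) s) = (narr s)(x := (narr s x)(nval i s := nval a s))"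
  "rvar (run (NStore x i a) s) = rvar s"
  "rarr (run (NStore x i a) s) = rarr s"
  "nvar (run (RStore x i b) s) = nvar s"
  "narr (run (RStore x i b) s) = narr s"
  "rvar (run (RStore x i b) s) = rvar s"
  "rarr (run (RStore x i b) s) = (rarr s)(x := (rarr s x)(nval i s := rval b s))"
  by (simp_all add: run.simps)

section \<open>Summaries held in registers and in arrays\<close>

definition reg :: "state \<Rightarrow> vname \<Rightarrow> nat summary" where
  "reg s X = (rvar s (X @ ''W''), rvar s (X @ ''Z''), rvar s (X @ ''S''), rvar s (X @ ''H''),
     nvar s (X @ ''F''))"

definition entry :: "state \<Rightarrow> vname \<Rightarrow> nat \<Rightarrow> nat summary" where
  "entry s A i = (rarr s (A @ ''W'') i, rarr s (A @ ''Z'') i, rarr s (A @ ''S'') i,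
     rarr s (A @ ''H'') i, narr s (A @ ''F'') i)"

text \<open>The cells of a summary are named by a prefix and one letter; as all suffixes have the
  same length, different prefixes never clash. The component \<open>F\<close> lives in the separate
  name space of naturals, so it gets its own side condition below.\<close>

definition reg_names :: "vname \<Rightarrow> vname list" where
  "reg_names X = [X @ ''W'', X @ ''Z'', X @ ''S'', X @ ''H'']"

lemma reg_entry_basic [simp]:
  "x \<noteq> X @ ''F'' \<Longrightarrow> reg (run (NAssign x a) s) X = reg s X"
  "x \<notin> set (reg_names X) \<Longrightarrow> reg (run (RAssign x b) s) X = reg s X"
  "reg (run (NStore x i a) s) = reg s"
  "reg (run (RStore x i b) s) = reg s"
  "entry (run (NAssign x a) s) = entry s"
  "entry (run (RAssign x b) s) = entry s"
  "x \<noteq> A @ ''F'' \<Longrightarrow> entry (run (NStore x i a) s) A = entry s A"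
  "x \<notin> set (reg_names A) \<Longrightarrow> entry (run (RStore x i b) s) A = entry s A"
  by (auto simp: reg_def entry_def reg_names_def fun_eq_iff)

definition load :: "vname \<Rightarrow> vname \<Rightarrow> vname \<Rightarrow> com" where
  "load X A y = block [
     RAssign (X @ ''W'') (RArr (A @ ''W'') (NVar y)),
     RAssign (X @ ''Z'') (RArr (A @ ''Z'') (NVar y)),
     RAssign (X @ ''S'') (RArr (A @ ''S'') (NVar y)),
     RAssign (X @ ''H'') (RArr (A @ ''H'') (NVar y)),
     NAssign (X @ ''F'') (NArr (A @ ''F'') (NVar y))]"

definition store :: "vname \<Rightarrow> vname \<Rightarrow> vname \<Rightarrow> com" where
  "store A y X = block [
     RStore (A @ ''W'') (NVar y) (RVar (X @ ''W'')),
     RStore (A @ ''Z'') (NVar y) (RVar (X @ ''Z'')),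
     RStore (A @ ''S'') (NVar y) (RVar (X @ ''S'')),
     RStore (A @ ''H'') (NVar y) (RVar (X @ ''H'')),
     NStore (A @ ''F'') (NVar y) (NVar (X @ ''F''))]"

definition join_reg :: "vname \<Rightarrow> vname \<Rightarrow> com" where
  "join_reg X Y = block [
     RAssign (X @ ''W'') (RAdd (RVar (X @ ''W'')) (RVar (Y @ ''W''))),
     RAssign (X @ ''Z'') (RAdd (RVar (X @ ''Z'')) (RVar (Y @ ''Z''))),
     RAssign (X @ ''S'') (RAdd (RVar (X @ ''S'')) (RVar (Y @ ''S''))),
     Cond (RLess (RVar (X @ ''H'')) (RVar (Y @ ''H'')))
       (Seq (RAssign (X @ ''H'') (RVar (Y @ ''H''))) (NAssign (X @ ''F'') (NVar (Y @ ''F''))))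
       Skip]"

definition shift_reg :: "vname \<Rightarrow> vname \<Rightarrow> com" where
  "shift_reg X c = block [
     RAssign (X @ ''S'') (RAdd (RVar (X @ ''S'')) (RMul (RVar (X @ ''W'')) (RVar c))),
     RAssign (X @ ''H'') (RAdd (RVar (X @ ''H'')) (RVar c))]"

definition singleton_reg :: "vname \<Rightarrow> vname \<Rightarrow> com" where
  "singleton_reg X y = block [
     RAssign (X @ ''W'') (RArr ''w'' (NVar y)),
     RAssign (X @ ''Z'') (RMul (RArr ''w'' (NVar y)) (RArr ''t'' (NVar y))),
     RAssign (X @ ''S'') (RConst 0),
     RAssign (X @ ''H'') (RConst 0),
     NAssign (X @ ''F'') (NVar y)]"

definition empty_reg :: "vname \<Rightarrow> com" where
  "empty_reg X = block [
     RAssign (X @ ''W'') (RConst 0),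
     RAssign (X @ ''Z'') (RConst 0),
     RAssign (X @ ''S'') (RConst 0),
     RAssign (X @ ''H'') (RConst (-1)),
     NAssign (X @ ''F'') (NConst 0)]"

definition far_reg :: "vname \<Rightarrow> nexp" where
  "far_reg X = NVar (X @ ''F'')"

definition evaluate :: "vname \<Rightarrow> vname \<Rightarrow> com" where
  "evaluate X Y = block [
     RAssign ''imb'' (RSub (RVar (X @ ''Z'')) (RVar (Y @ ''Z''))),
     Cond (RLess (RVar ''imb'') (RConst 0)) (RAssign ''imb'' (RSub (RConst 0) (RVar ''imb''))) Skip,
     RAssign ''obj'' (RSub
       (RMul (RVar ''lambda'') (RAdd
         (RAdd (RVar (X @ ''S'')) (RMul (RVar (X @ ''W'')) (RAdd (RVar ''len'') (RVar (Y @ ''H'')))))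
         (RAdd (RVar (Y @ ''S'')) (RMul (RVar (Y @ ''W'')) (RAdd (RVar ''len'') (RVar (X @ ''H'')))))))
       (RMul (RSub (RConst 1) (RVar ''lambda'')) (RVar ''imb'')))]"

lemmas macro_defs = load_def store_def join_reg_def shift_reg_def singleton_reg_def empty_reg_def
  evaluate_def

lemma loopfree_macros [simp]:
  "loopfree (load X A y)" "loopfree (store A y X)" "loopfree (join_reg X Y)"
  "loopfree (shift_reg X c)" "loopfree (singleton_reg X y)" "loopfree (empty_reg X)"
  "loopfree (evaluate X Y)"
  by (simp_all add: macro_defs)

text \<open>This and the following rules describe each macro by its effect on whole summaries, so
  that the steps of the algorithm are later simplified without looking at single components.\<close>

lemma load_simps [simp]:
  "y \<noteq> X @ ''F'' \<Longrightarrow> reg (run (load X A y) s) = (reg s)(X := entry s A (nvar s y))"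
  "z \<noteq> X @ ''F'' \<Longrightarrow> nvar (run (load X A y) s) z = nvar s z"
  "z \<notin> set (reg_names X) \<Longrightarrow> rvar (run (load X A y) s) z = rvar s z"
  "narr (run (load X A y) s) = narr s" "rarr (run (load X A y) s) = rarr s"
  "entry (run (load X A y) s) = entry s"
  by (auto simp: load_def reg_def entry_def reg_names_def fun_eq_iff)

lemma store_simps [simp]:
  "entry (run (store A y X) s) = (entry s)(A := (entry s A)(nvar s y := reg s X))"
  "z \<noteq> A @ ''F'' \<Longrightarrow> narr (run (store A y X) s) z = narr s z"
  "z \<notin> set (reg_names A) \<Longrightarrow> rarr (run (store A y X) s) z = rarr s z"
  "nvar (run (store A y X) s) = nvar s" "rvar (run (store A y X) s) = rvar s"
  "reg (run (store A y X) s) = reg s"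
  by (auto simp: store_def reg_def entry_def reg_names_def fun_eq_iff)

lemma join_reg_simps [simp]:
  "X \<noteq> Y \<Longrightarrow> reg (run (join_reg X Y) s) = (reg s)(X := join (reg s X) (reg s Y))"
  "z \<noteq> X @ ''F'' \<Longrightarrow> nvar (run (join_reg X Y) s) z = nvar s z"
  "z \<notin> set (reg_names X) \<Longrightarrow> rvar (run (join_reg X Y) s) z = rvar s z"
  "narr (run (join_reg X Y) s) = narr s" "rarr (run (join_reg X Y) s) = rarr s"
  "entry (run (join_reg X Y) s) = entry s"
  by (auto simp: join_reg_def reg_def entry_def reg_names_def fun_eq_iff)

lemma shift_reg_simps [simp]:
  "c \<notin> set (reg_names X) \<Longrightarrow> reg (run (shift_reg X c) s) = (reg s)(X := shift (rvar s c) (reg s X))"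
  "z \<notin> set (reg_names X) \<Longrightarrow> rvar (run (shift_reg X c) s) z = rvar s z"
  "nvar (run (shift_reg X c) s) = nvar s"
  "narr (run (shift_reg X c) s) = narr s" "rarr (run (shift_reg X c) s) = rarr s"
  "entry (run (shift_reg X c) s) = entry s"
  by (auto simp: shift_reg_def reg_def entry_def reg_names_def fun_eq_iff)

lemma singleton_reg_simps [simp]:
  "y \<noteq> X @ ''F'' \<Longrightarrow> reg (run (singleton_reg X y) s) = (reg s)(X :=
     (rarr s ''w'' (nvar s y), rarr s ''w'' (nvar s y) * rarr s ''t'' (nvar s y), 0, 0, nvar s y))"
  "z \<noteq> X @ ''F'' \<Longrightarrow> nvar (run (singleton_reg X y) s) z = nvar s z"
  "z \<notin> set (reg_names X) \<Longrightarrow> rvar (run (singleton_reg X y) s) z = rvar s z"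
  "narr (run (singleton_reg X y) s) = narr s" "rarr (run (singleton_reg X y) s) = rarr s"
  "entry (run (singleton_reg X y) s) = entry s"
  by (auto simp: singleton_reg_def reg_def entry_def reg_names_def fun_eq_iff)

lemma empty_reg_simps [simp]:
  "reg (run (empty_reg X) s) = (reg s)(X := (0, 0, 0, -1, 0))"
  "z \<noteq> X @ ''F'' \<Longrightarrow> nvar (run (empty_reg X) s) z = nvar s z"
  "z \<notin> set (reg_names X) \<Longrightarrow> rvar (run (empty_reg X) s) z = rvar s z"
  "narr (run (empty_reg X) s) = narr s" "rarr (run (empty_reg X) s) = rarr s"
  "entry (run (empty_reg X) s) = entry s"
  by (auto simp: empty_reg_def reg_def entry_def reg_names_def fun_eq_iff)

lemma nval_far_reg [simp]: "nval (far_reg X) s = farthest (reg s X)"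
  by (simp add: far_reg_def reg_def)

lemma evaluate_simps [simp]:
  "\<lbrakk>set (reg_names X) \<inter> {''imb'', ''obj''} = {}; set (reg_names Y) \<inter> {''imb'', ''obj''} = {}\<rbrakk> \<Longrightarrow>
     rvar (run (evaluate X Y) s) ''obj'' =
       edge_value (rvar s ''lambda'') (rvar s ''len'') (reg s X) (reg s Y)"
  "z \<noteq> ''imb'' \<Longrightarrow> z \<noteq> ''obj'' \<Longrightarrow> rvar (run (evaluate X Y) s) z = rvar s z"
  "set (reg_names V) \<inter> {''imb'', ''obj''} = {} \<Longrightarrow> reg (run (evaluate X Y) s) V = reg s V"
  "nvar (run (evaluate X Y) s) = nvar s"
  "narr (run (evaluate X Y) s) = narr s" "rarr (run (evaluate X Y) s) = rarr s"
  "entry (run (evaluate X Y) s) = entry s"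
  by (auto simp: evaluate_def reg_def entry_def reg_names_def fun_eq_iff)

section \<open>The steps of the program\<close>

abbreviation inc :: "vname \<Rightarrow> com" where
  "inc x \<equiv> NAssign x (NAdd (NVar x) (NConst 1))"

text \<open>
  Instead of adjacency lists, the program keeps for every vertex its degree \<open>deg\<close> and the sum
  \<open>inc\<close> of the indices of its remaining incident edges. At a leaf this sum is the index of its only
  edge, whose other endpoint is \<open>src + dst - v\<close>.
\<close>

definition count_endpoint :: "vname \<Rightarrow> com" where
  "count_endpoint end = block [
     NAssign ''v'' (NArr end (NVar ''i'')),
     NStore ''deg'' (NVar ''v'') (NAdd (NArr ''deg'' (NVar ''v'')) (NConst 1)),
     NStore ''inc'' (NVar ''v'') (NAdd (NArr ''inc'' (NVar ''v'')) (NVar ''i''))]"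

definition init_step :: com where
  "init_step = block [
     singleton_reg ''a'' ''i'',
     store ''A'' ''i'' ''a'',
     NStore ''deg'' (NVar ''i'') (NConst 0),
     NStore ''inc'' (NVar ''i'') (NConst 0),
     inc ''i'']"

definition count_step :: com where
  "count_step = block [count_endpoint ''src'', count_endpoint ''dst'', inc ''i'']"

text \<open>\<open>P\<close> is filled before the entry of \<open>p\<close> is overwritten by the
  join. Ending at \<open>p\<close> lets the next test catch \<open>p\<close> if it has become a
  leaf.\<close>

definition prune_step :: com where
  "prune_step = block [
     NAssign ''e'' (NArr ''inc'' (NVar ''v'')),
     NAssign ''p'' (NSub (NAdd (NArr ''src'' (NVar ''e'')) (NArr ''dst'' (NVar ''e''))) (NVar ''v'')),
     RAssign ''len'' (RArr ''len'' (NVar ''e'')),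
     NStore ''ord'' (NVar ''cnt'') (NVar ''v''),
     NStore ''par'' (NVar ''cnt'') (NVar ''p''),
     NStore ''eid'' (NVar ''cnt'') (NVar ''e''),
     load ''a'' ''A'' ''v'',
     load ''b'' ''A'' ''p'',
     store ''P'' ''cnt'' ''b'',
     shift_reg ''a'' ''len'',
     join_reg ''b'' ''a'',
     store ''A'' ''p'' ''b'',
     NStore ''deg'' (NVar ''v'') (NSub (NArr ''deg'' (NVar ''v'')) (NConst 1)),
     NStore ''deg'' (NVar ''p'') (NSub (NArr ''deg'' (NVar ''p'')) (NConst 1)),
     NStore ''inc'' (NVar ''v'') (NSub (NArr ''inc'' (NVar ''v'')) (NVar ''e'')),
     NStore ''inc'' (NVar ''p'') (NSub (NArr ''inc'' (NVar ''p'')) (NVar ''e'')),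
     inc ''cnt'',
     NAssign ''v'' (NVar ''p'')]"

text \<open>The root \<open>0\<close> must never be pruned, even when its degree is one.\<close>

definition leaf_test :: bexp where
  "leaf_test = BAnd (NLess (NConst 0) (NVar ''v'')) (NEq (NArr ''deg'' (NVar ''v'')) (NConst 1))"

text \<open>
  Leaves are found by scanning the vertices with \<open>i\<close>; a neighbour that becomes a leaf by a pruning is
  pruned next, even if the scan has already passed it.
\<close>

definition forward_step :: com where
  "forward_step = Cond leaf_test prune_step (block [inc ''i'', NAssign ''v'' (NVar ''i'')])"

text \<open>At the first visit, when \<open>k + 1 = cnt\<close>, \<open>value\<close> is not yet
  meaningful, so that candidate is always taken. The test is phrased negatively because the language
  has no disjunction. \<open>x1\<close> serves the side summarised in \<open>a\<close> and hence is
  taken from \<open>b\<close>.\<close>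

definition update_best :: com where
  "update_best =
     Cond (BAnd (NLess (NAdd (NVar ''k'') (NConst 1)) (NVar ''cnt''))
         (BNot (RLess (RVar ''value'') (RVar ''obj''))))
       Skip
       (block [
          RAssign ''value'' (RVar ''obj''),
          NAssign ''edge'' (NVar ''e''),
          NAssign ''x1'' (far_reg ''b''),
          NAssign ''x2'' (far_reg ''a'')])"

abbreviation keep_best :: "state \<Rightarrow> bool" where
  "keep_best s \<equiv> Suc (nvar s ''k'') < nvar s ''cnt'' \<and> rvar s ''obj'' \<le> rvar s ''value''"

lemma update_best_simps [simp]:
  "loopfree update_best"
  "rvar (run update_best s) ''value'' = (if keep_best s then rvar s ''value'' else rvar s ''obj'')"
  "nvar (run update_best s) ''edge'' = (if keep_best s then nvar s ''edge'' else nvar s ''e'')"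
  "nvar (run update_best s) ''x1'' =
     (if keep_best s then nvar s ''x1'' else farthest (reg s ''b''))"
  "nvar (run update_best s) ''x2'' =
     (if keep_best s then nvar s ''x2'' else farthest (reg s ''a''))"
  "z \<noteq> ''value'' \<Longrightarrow> rvar (run update_best s) z = rvar s z"
  "z \<noteq> ''edge'' \<Longrightarrow> z \<noteq> ''x1'' \<Longrightarrow> z \<noteq> ''x2'' \<Longrightarrow>
     nvar (run update_best s) z = nvar s z"
  "narr (run update_best s) = narr s" "rarr (run update_best s) = rarr s"
  "entry (run update_best s) = entry s"
  "X \<in> {''a'', ''b'', ''c''} \<Longrightarrow> reg (run update_best s) X = reg s X"
  by (auto simp: update_best_def reg_names_def)

lemma init_step_simps:
  "entry (run init_step s) ''A'' = (entry s ''A'')(nvar s ''i'' :=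
     (rarr s ''w'' (nvar s ''i''), rarr s ''w'' (nvar s ''i'') * rarr s ''t'' (nvar s ''i''), 0, 0,
      nvar s ''i''))"
  "narr (run init_step s) ''deg'' = (narr s ''deg'')(nvar s ''i'' := 0)"
  "narr (run init_step s) ''inc'' = (narr s ''inc'')(nvar s ''i'' := 0)"
  "nvar (run init_step s) ''i'' = Suc (nvar s ''i'')"
  "nvar (run init_step s) ''n'' = nvar s ''n''"
  "rvar (run init_step s) ''lambda'' = rvar s ''lambda''"
  "x \<in> {''src'', ''dst''} \<Longrightarrow> narr (run init_step s) x = narr s x"
  "x \<in> {''len'', ''w'', ''t''} \<Longrightarrow> rarr (run init_step s) x = rarr s x"
  by (auto simp: init_step_def reg_names_def)

lemma count_endpoint_simps:
  "narr (run (count_endpoint x) s) ''deg'' =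
     (narr s ''deg'')(narr s x (nvar s ''i'') := Suc (narr s ''deg'' (narr s x (nvar s ''i''))))"
  "narr (run (count_endpoint x) s) ''inc'' = (narr s ''inc'')(narr s x (nvar s ''i'') :=
     narr s ''inc'' (narr s x (nvar s ''i'')) + nvar s ''i'')"
  "z \<noteq> ''v'' \<Longrightarrow> nvar (run (count_endpoint x) s) z = nvar s z"
  "z \<noteq> ''deg'' \<Longrightarrow> z \<noteq> ''inc'' \<Longrightarrow> narr (run (count_endpoint x) s) z = narr s z"
  "rvar (run (count_endpoint x) s) = rvar s" "rarr (run (count_endpoint x) s) = rarr s"
  "entry (run (count_endpoint x) s) ''A'' = entry s ''A''"
  "loopfree (count_endpoint x)"
  by (auto simp: count_endpoint_def)

lemma count_step_simps:
  assumes "i = nvar s ''i''" "u = narr s ''src'' i" "v = narr s ''dst'' i" "u \<noteq> v"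
  shows
    "narr (run count_step s) ''deg'' =
       (narr s ''deg'')(u := Suc (narr s ''deg'' u), v := Suc (narr s ''deg'' v))"
    "narr (run count_step s) ''inc'' =
       (narr s ''inc'')(u := narr s ''inc'' u + i, v := narr s ''inc'' v + i)"
    "nvar (run count_step s) ''i'' = Suc i"
    "nvar (run count_step s) ''n'' = nvar s ''n''"
    "rvar (run count_step s) = rvar s" "rarr (run count_step s) = rarr s"
    "entry (run count_step s) ''A'' = entry s ''A''"
    "x \<in> {''src'', ''dst''} \<Longrightarrow> narr (run count_step s) x = narr s x"
  using assms(4) unfolding assms(1-3) by (auto simp: count_step_def count_endpoint_simps)

text \<open>The hypotheses name the values read from the initial state, which keeps the conclusions
  short. \<open>p \<noteq> v\<close> keeps the updates at the two vertices apart.\<close>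

lemma prune_step_simps:
  assumes "k = nvar s ''cnt''" "v = nvar s ''v''" "e = narr s ''inc'' v"
    "p = narr s ''src'' e + narr s ''dst'' e - v" "p \<noteq> v"
  shows
    "narr (run prune_step s) ''ord'' = (narr s ''ord'')(k := v)"
    "narr (run prune_step s) ''par'' = (narr s ''par'')(k := p)"
    "narr (run prune_step s) ''eid'' = (narr s ''eid'')(k := e)"
    "narr (run prune_step s) ''deg'' =
       (narr s ''deg'')(v := narr s ''deg'' v - 1, p := narr s ''deg'' p - 1)"
    "narr (run prune_step s) ''inc'' =
       (narr s ''inc'')(v := narr s ''inc'' v - e, p := narr s ''inc'' p - e)"
    "entry (run prune_step s) ''P'' = (entry s ''P'')(k := entry s ''A'' p)"
    "entry (run prune_step s) ''A'' = (entry s ''A'')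
       (p := join (entry s ''A'' p) (shift (rarr s ''len'' e) (entry s ''A'' v)))"
    "nvar (run prune_step s) ''cnt'' = Suc k"
    "nvar (run prune_step s) ''v'' = p"
    "x \<in> {''n'', ''i''} \<Longrightarrow> nvar (run prune_step s) x = nvar s x"
    "rvar (run prune_step s) ''lambda'' = rvar s ''lambda''"
    "x \<in> {''src'', ''dst''} \<Longrightarrow> narr (run prune_step s) x = narr s x"
    "x \<in> {''len'', ''w'', ''t''} \<Longrightarrow> rarr (run prune_step s) x = rarr s x"
  using assms(5) unfolding assms(1-4) by (auto simp: prune_step_def reg_names_def)

lemma loopfree_steps [simp]:
  "loopfree init_step" "loopfree count_step" "loopfree forward_step"
  by (simp_all add: init_step_def count_step_def count_endpoint_simps forward_step_def prune_step_def)
text \<open>Register \<open>a\<close> receives the side of \<open>v\<close>, \<open>c\<close> what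
  lies outside the merged cluster of \<open>p\<close>, and \<open>b\<close> everything outside the
  side of \<open>v\<close>, seen from \<open>p\<close>.\<close>

definition visit :: com where
  "visit = block [
     NAssign ''k'' (NSub (NVar ''k'') (NConst 1)),
     NAssign ''v'' (NArr ''ord'' (NVar ''k'')),
     NAssign ''p'' (NArr ''par'' (NVar ''k'')),
     NAssign ''e'' (NArr ''eid'' (NVar ''k'')),
     RAssign ''len'' (RArr ''len'' (NVar ''e'')),
     load ''a'' ''A'' ''v'',
     load ''b'' ''P'' ''k'',
     load ''c'' ''B'' ''p'',
     join_reg ''b'' ''c'',
     evaluate ''a'' ''b'']"

text \<open>Both new entries depend on the old entry of \<open>B\<close> at \<open>p\<close>, so
  they are computed in registers before anything is stored.\<close>

definition propagate :: com where
  "propagate = block [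
     shift_reg ''a'' ''len'',
     shift_reg ''b'' ''len'',
     join_reg ''c'' ''a'',
     store ''B'' ''p'' ''c'',
     store ''B'' ''v'' ''b'']"

definition backward_step :: com where
  "backward_step = block [visit, update_best, propagate]"

lemma visit_simps:
  assumes "k = nvar s ''k'' - 1" "v = narr s ''ord'' k" "p = narr s ''par'' k" "e = narr s ''eid'' k"
  shows "nvar (run visit s) ''k'' = k" "nvar (run visit s) ''v'' = v"
    "nvar (run visit s) ''p'' = p" "nvar (run visit s) ''e'' = e"
    "rvar (run visit s) ''len'' = rarr s ''len'' e"
    "reg (run visit s) ''a'' = entry s ''A'' v"
    "reg (run visit s) ''b'' = join (entry s ''P'' k) (entry s ''B'' p)"
    "reg (run visit s) ''c'' = entry s ''B'' p"
    "rvar (run visit s) ''obj'' = edge_value (rvar s ''lambda'') (rarr s ''len'' e) (entry s ''A'' v)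
       (join (entry s ''P'' k) (entry s ''B'' p))"
    "rvar (run visit s) ''value'' = rvar s ''value''"
    "x \<in> {''n'', ''cnt'', ''edge'', ''x1'', ''x2''} \<Longrightarrow> nvar (run visit s) x = nvar s x"
    "rvar (run visit s) ''lambda'' = rvar s ''lambda''"
    "narr (run visit s) = narr s" "rarr (run visit s) = rarr s" "entry (run visit s) = entry s"
  unfolding assms by (auto simp: visit_def reg_names_def)

lemma propagate_simps:
  "entry (run propagate s) = (entry s)(''B'' := (entry s ''B'')
     (nvar s ''p'' := join (reg s ''c'') (shift (rvar s ''len'') (reg s ''a'')),
      nvar s ''v'' := shift (rvar s ''len'') (reg s ''b'')))"
  "x \<in> {''n'', ''k'', ''cnt'', ''edge'', ''x1'', ''x2''} \<Longrightarrow> nvar (run propagate s) x = nvar s x"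
  "x \<in> {''value'', ''lambda''} \<Longrightarrow> rvar (run propagate s) x = rvar s x"
  "x \<in> {''ord'', ''par'', ''eid'', ''src'', ''dst''} \<Longrightarrow> narr (run propagate s) x = narr s x"
  "x \<in> {''len'', ''w'', ''t''} \<Longrightarrow> rarr (run propagate s) x = rarr s x"
  by (auto simp: propagate_def reg_names_def)

lemma backward_step_simps:
  assumes "k = nvar s ''k'' - 1" "v = narr s ''ord'' k" "p = narr s ''par'' k" "e = narr s ''eid'' k"
    "c = rarr s ''len'' e" "a = entry s ''A'' v" "b = join (entry s ''P'' k) (entry s ''B'' p)"
    "obj = edge_value (rvar s ''lambda'') c a b"
    "keep \<longleftrightarrow> Suc k < nvar s ''cnt'' \<and> obj \<le> rvar s ''value''"
  shows
    "entry (run backward_step s) =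
       (entry s)(''B'' := (entry s ''B'')(p := join (entry s ''B'' p) (shift c a), v := shift c b))"
    "nvar (run backward_step s) ''k'' = k"
    "rvar (run backward_step s) ''value'' = (if keep then rvar s ''value'' else obj)"
    "nvar (run backward_step s) ''edge'' = (if keep then nvar s ''edge'' else e)"
    "nvar (run backward_step s) ''x1'' = (if keep then nvar s ''x1'' else farthest b)"
    "nvar (run backward_step s) ''x2'' = (if keep then nvar s ''x2'' else farthest a)"
    "x \<in> {''n'', ''cnt''} \<Longrightarrow> nvar (run backward_step s) x = nvar s x"
    "rvar (run backward_step s) ''lambda'' = rvar s ''lambda''"
    "x \<in> {''ord'', ''par'', ''eid'', ''src'', ''dst''} \<Longrightarrow> narr (run backward_step s) x = narr s x"
    "x \<in> {''len'', ''w'', ''t''} \<Longrightarrow> rarr (run backward_step s) x = rarr s x"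
  unfolding backward_step_def assms(9)
  by (auto simp: visit_simps[OF assms(1-4)] propagate_simps assms(5-8)[symmetric])

lemma loopfree_backward_step [simp]: "loopfree backward_step"
  by (simp add: backward_step_def visit_def propagate_def)

section \<open>Loop invariants\<close>

definition init_loop :: com where
  "init_loop = While (NLess (NVar ''i'') (NVar ''n'')) init_step"

definition count_loop :: com where
  "count_loop = While (NLess (NAdd (NVar ''i'') (NConst 1)) (NVar ''n'')) count_step"

definition forward_loop :: com where
  "forward_loop = While (NLess (NAdd (NVar ''cnt'') (NConst 1)) (NVar ''n'')) forward_step"

definition backward_loop :: com where
  "backward_loop = While (NLess (NConst 0) (NVar ''k'')) backward_step"

definition prepare_forward :: com where
  "prepare_forward =
     block [NAssign ''cnt'' (NConst 0), NAssign ''i'' (NConst 0), NAssign ''v'' (NConst 0)]"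

text \<open>Once pruning is complete only the root remains, so no other entry of \<open>B\<close>
  needs a value yet. Nothing lies outside its cluster, hence the empty summary.\<close>

definition prepare_backward :: com where
  "prepare_backward = block [NAssign ''v'' (NConst 0), empty_reg ''a'', store ''B'' ''v'' ''a'',
     NAssign ''k'' (NVar ''cnt'')]"

definition solve :: com where
  "solve = Seq (NAssign ''i'' (NConst 0)) (Seq init_loop (Seq (NAssign ''i'' (NConst 0))
     (Seq count_loop (Seq prepare_forward (Seq forward_loop (Seq prepare_backward backward_loop))))))"

text \<open>The two single assignments cost \<open>4\<close>; the tests and branchings of the loops
  cost \<open>4 + 6 + 6 + 4 = 20\<close>. The factor \<open>3\<close> comes from the forward loop,
  with at most \<open>2 * n\<close> iterations and a final test, and is used for all loops.\<close>

definition solve_cost :: nat where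
  "solve_cost = 4 + maxcost prepare_forward + maxcost prepare_backward +
     3 * (20 + maxcost init_step + maxcost count_step + maxcost forward_step + maxcost backward_step)"

definition history :: "state \<Rightarrow> nat \<Rightarrow> (nat \<times> nat) list" where
  "history s k = map (\<lambda>j. (narr s ''ord'' j, narr s ''par'' j)) [0..<k]"

lemma history_0 [simp]: "history s 0 = []"
  by (simp add: history_def)

lemma history_Suc: "history s (Suc k) = history s k @ [(narr s ''ord'' k, narr s ''par'' k)]"
  by (simp add: history_def)

lemma history_cong:
  "(\<And>j. j < k \<Longrightarrow> narr s' ''ord'' j = narr s ''ord'' j \<and> narr s' ''par'' j = narr s ''par'' j) \<Longrightarrow>
     history s' k = history s k"
  by (simp add: history_def)

lemma length_history [simp]: "length (history s k) = k"
  by (simp add: history_def)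

section \<open>The instance and its edge indices\<close>

locale maxian_instance = maxian_tree "{..<n}" E l w t lam
  for n :: nat and E :: "nat set set" and l :: "nat set \<Rightarrow> real" and w t :: "nat \<Rightarrow> real"
    and lam :: real +
  fixes s0 :: state
  assumes two: "2 \<le> n" and input: "holds_input s0 n E l w t lam"
begin

abbreviation edge :: "nat \<Rightarrow> nat set" where "edge \<equiv> listed_edge s0"

lemma card_E: "card E = n - 1"
  using card_edges by simp

lemma edge_bij: "bij_betw edge {..<n - 1} E"
  using input by (simp add: holds_input_def card_E)

lemma edge_in_E: "i < n - 1 \<Longrightarrow> edge i \<in> E"
  using edge_bij by (auto simp: bij_betw_def)

lemma edge_ends:
  assumes "i < n - 1"
  shows "narr s0 ''src'' i < n" "narr s0 ''dst'' i < n" "narr s0 ''src'' i \<noteq> narr s0 ''dst'' i"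
  using edgeD[of "narr s0 ''src'' i" "narr s0 ''dst'' i"] edge_in_E[OF assms]
  by (auto simp: listed_edge_def)

definition same_input :: "state \<Rightarrow> bool" where
  "same_input s \<longleftrightarrow> nvar s ''n'' = n \<and> rvar s ''lambda'' = lam \<and>
     (\<forall>x\<in>{''src'', ''dst''}. narr s x = narr s0 x) \<and>
     (\<forall>x\<in>{''len'', ''w'', ''t''}. rarr s x = rarr s0 x)"

lemma same_input_s0: "same_input s0"
  using input by (simp add: same_input_def holds_input_def)

lemma same_inputD:
  assumes "same_input s"
  shows "nvar s ''n'' = n" "rvar s ''lambda'' = lam"
    "narr s ''src'' = narr s0 ''src''" "narr s ''dst'' = narr s0 ''dst''"
    "i < n - 1 \<Longrightarrow> rarr s ''len'' i = l (edge i)"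
    "v < n \<Longrightarrow> rarr s ''w'' v = w v" "v < n \<Longrightarrow> rarr s ''t'' v = t v"
  using assms input by (auto simp: same_input_def holds_input_def card_E)

definition incident :: "nat set \<Rightarrow> nat \<Rightarrow> nat set" where
  "incident I u = {i \<in> I. u \<in> edge i}"

text \<open>Stated for a set of edge indices so that it serves two phases: the edges already read
  while counting, and the alive edges while pruning.\<close>

definition degrees :: "state \<Rightarrow> nat set \<Rightarrow> bool" where
  "degrees s I \<longleftrightarrow> (\<forall>u<n. narr s ''deg'' u = card (incident I u) \<and>
     narr s ''inc'' u = \<Sum>(incident I u))"

definition alive :: "nat set \<Rightarrow> nat set" where
  "alive R = {i. i < n - 1 \<and> edge i \<subseteq> R}"

lemma finite_incident [simp]: "finite I \<Longrightarrow> finite (incident I u)"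
  by (simp add: incident_def)

lemma finite_alive [simp]: "finite (alive R)"
  by (simp add: alive_def)

lemma edge_image: "edge ` incident (alive R) u = {e \<in> E. e \<subseteq> R \<and> u \<in> e}"
  using edge_bij by (auto simp: incident_def alive_def bij_betw_def image_iff)

lemma card_incident: "card (incident (alive R) u) = card {e \<in> E. e \<subseteq> R \<and> u \<in> e}"
proof -
  have "inj_on edge (incident (alive R) u)"
    using edge_bij by (auto simp: bij_betw_def incident_def alive_def intro: inj_on_subset)
  from card_image[OF this] show ?thesis by (simp add: edge_image)
qed

section \<open>Initialisation and degree counting\<close>

definition init_inv :: "state \<Rightarrow> bool" where
  "init_inv s \<longleftrightarrow> same_input s \<and> nvar s ''i'' \<le> n \<and>
     (\<forall>u<nvar s ''i''. entry s ''A'' u = (w u, w u * t u, 0, 0, u) \<and>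
        narr s ''deg'' u = 0 \<and> narr s ''inc'' u = 0)"

lemma init_loop_correct:
  assumes "init_inv s"
  shows "runs init_loop s ((4 + maxcost init_step) * (3 * n))
    (\<lambda>s'. init_inv s' \<and> nvar s' ''i'' = n)"
proof -
  let ?b = "NLess (NVar ''i'') (NVar ''n'')"
  have step: "init_inv (run init_step s) \<and> n - nvar (run init_step s) ''i'' < n - nvar s ''i''"
    if I: "init_inv s" and b: "bval ?b s" for s
  proof -
    have si: "same_input s" using I by (simp add: init_inv_def)
    note D = same_inputD[OF si]
    have "nvar s ''i'' < n" using b D(1) by simp
    moreover have "same_input (run init_step s)"
      using si by (simp add: same_input_def init_step_simps)
    ultimately show ?thesis
      using I D by (auto simp: init_inv_def init_step_simps less_Suc_eq)
  qed
  have "runs init_loop s ((1 + bcost ?b + maxcost init_step) * Suc (n - nvar s ''i''))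
      (\<lambda>s'. init_inv s' \<and> \<not> bval ?b s')"
    unfolding init_loop_def by (rule runs_While[where I = init_inv, OF _ step assms]) simp_all
  then show ?thesis
  proof (rule runs_mono)
    show "(1 + bcost ?b + maxcost init_step) * Suc (n - nvar s ''i'') \<le>
        (4 + maxcost init_step) * (3 * n)"
      using two by (intro mult_le_mono) auto
  qed (auto simp: init_inv_def same_input_def)
qed

definition count_inv :: "state \<Rightarrow> bool" where
  "count_inv s \<longleftrightarrow> same_input s \<and> Suc (nvar s ''i'') \<le> n \<and>
     (\<forall>u<n. entry s ''A'' u = (w u, w u * t u, 0, 0, u)) \<and> degrees s {..<nvar s ''i''}"

lemma count_loop_correct:
  assumes "count_inv s"
  shows "runs count_loop s ((6 + maxcost count_step) * (3 * n))
    (\<lambda>s'. count_inv s' \<and> nvar s' ''i'' = n - 1)"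
proof -
  let ?b = "NLess (NAdd (NVar ''i'') (NConst 1)) (NVar ''n'')"
  have step: "count_inv (run count_step s) \<and> n - nvar (run count_step s) ''i'' < n - nvar s ''i''"
    if I: "count_inv s" and b: "bval ?b s" for s
  proof -
    have si: "same_input s" using I by (simp add: count_inv_def)
    note D = same_inputD[OF si]
    define i where "i = nvar s ''i''"
    define a where "a = narr s ''src'' i"
    define c where "c = narr s ''dst'' i"
    have i: "i < n - 1" using b D(1) by (simp add: i_def)
    have ac: "edge i = {a, c}" "a \<noteq> c"
      using edge_ends[OF i] D(3,4) by (simp_all add: a_def c_def listed_edge_def)
    note S = count_step_simps[OF i_def a_def c_def ac(2)]
    have inc: "incident {..<Suc i} u =
        (if u \<in> {a, c} then insert i (incident {..<i} u) else incident {..<i} u)" for u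
      using ac by (auto simp: incident_def less_Suc_eq)
    have "i \<notin> incident {..<i} u" for u by (simp add: incident_def)
    then have "degrees (run count_step s) {..<Suc i}"
      using I ac(2) by (auto simp: degrees_def count_inv_def S inc i_def[symmetric])
    moreover have "same_input (run count_step s)" using si by (simp add: same_input_def S)
    ultimately show ?thesis using I i by (auto simp: count_inv_def S i_def)
  qed
  have "runs count_loop s ((1 + bcost ?b + maxcost count_step) * Suc (n - nvar s ''i''))
      (\<lambda>s'. count_inv s' \<and> \<not> bval ?b s')"
    unfolding count_loop_def by (rule runs_While[where I = count_inv, OF _ step assms]) simp_all
  then show ?thesis
  proof (rule runs_mono)
    show "(1 + bcost ?b + maxcost count_step) * Suc (n - nvar s ''i'') \<le>
        (6 + maxcost count_step) * (3 * n)"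
      using two by (intro mult_le_mono) auto
  qed (auto simp: count_inv_def same_input_def)
qed

section \<open>The forward pass\<close>

text \<open>This is what the backward pass relies on. The entry of \<open>A\<close> at a pruned
  vertex still describes its cluster at the time of pruning, since later prunings write only to
  entries of remaining vertices.\<close>

definition recorded :: "state \<Rightarrow> nat \<Rightarrow> bool" where
  "recorded s m \<longleftrightarrow> (\<forall>k<m. narr s ''eid'' k < n - 1 \<and>
     edge (narr s ''eid'' k) = {narr s ''ord'' k, narr s ''par'' k} \<and>
     summarises (entry s ''A'' (narr s ''ord'' k))
       (cluster (history s k) (narr s ''ord'' k)) (narr s ''ord'' k) \<and>
     summarises (entry s ''P'' k) (cluster (history s k) (narr s ''par'' k)) (narr s ''par'' k))"

text \<open>The last conjunct drives the leaf search: a leaf other than the root that the scan has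
  reached or passed can only be the current \<open>v\<close>. With the existence of a leaf it keeps
  \<open>i\<close> below \<open>n\<close> while prunings are missing.\<close>

definition forward_inv :: "state \<Rightarrow> bool" where
  "forward_inv s \<longleftrightarrow> (let m = nvar s ''cnt''; h = history s m in
     same_input s \<and> Suc m \<le> n \<and> nvar s ''v'' < n \<and> nvar s ''i'' < n \<and> pruning 0 h \<and>
     (\<forall>u\<in>remaining h. summarises (entry s ''A'' u) (cluster h u) u) \<and>
     degrees s (alive (remaining h)) \<and> recorded s m \<and>
     (\<forall>u\<in>remaining h. u \<noteq> 0 \<longrightarrow> narr s ''deg'' u = 1 \<longrightarrow> u = nvar s ''v'' \<or> nvar s ''i'' < u))"

lemma prune_step_correct:
  assumes I: "forward_inv s" and v: "0 < nvar s ''v''" "narr s ''deg'' (nvar s ''v'') = 1"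
    and more: "Suc (nvar s ''cnt'') < n"
  shows "forward_inv (run prune_step s)"
proof -
  define m v e p h s' where "m = nvar s ''cnt''" and "v = nvar s ''v''" and "e = narr s ''inc'' v"
    and "p = narr s ''src'' e + narr s ''dst'' e - v" and "h = history s m"
    and "s' = run prune_step s"
  have si: "same_input s" and vn: "v < n" and pr: "pruning 0 h" and rec: "recorded s m"
    and A: "\<And>u. u \<in> remaining h \<Longrightarrow> summarises (entry s ''A'' u) (cluster h u) u"
    and deg: "degrees s (alive (remaining h))" and i: "nvar s ''i'' < n"
    and leaves: "\<And>u. u \<in> remaining h \<Longrightarrow> u \<noteq> 0 \<Longrightarrow> narr s ''deg'' u = 1 \<Longrightarrow>
      u = v \<or> nvar s ''i'' < u"
    using I by (auto simp: forward_inv_def Let_def m_def v_def h_def)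
  note D = same_inputD[OF si]
  have "card (incident (alive (remaining h)) v) = 1"
    using deg v(2) vn by (auto simp: degrees_def v_def)
  then obtain j where j: "incident (alive (remaining h)) v = {j}" by (rule card_1_singletonE)
  \<comment> \<open>The sum of a one-element index set is its element, so \<open>inc\<close> yields
    the edge itself.\<close>
  have "e = j" using deg vn by (simp add: degrees_def e_def j)
  then have e: "e < n - 1" "edge e \<subseteq> remaining h" "v \<in> edge e"
    using j by (auto simp: incident_def alive_def)
  have vp: "edge e = {v, p}" "p \<noteq> v"
    using e(3) edge_ends[OF e(1)] D(3,4) by (auto simp: listed_edge_def p_def)
  have leaf: "{f \<in> E. f \<subseteq> remaining h \<and> v \<in> f} = {{v, p}}"
    using edge_image[of "remaining h" v] by (simp add: j \<open>e = j\<close>[symmetric] vp)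
  have rem: "v \<in> remaining h" "p \<in> remaining h" "p < n"
    using e(2) vp by (auto simp: remaining_def)
  have pr': "pruning 0 (h @ [(v, p)])"
    by (rule pruning.Snoc[OF pr rem(1,2) vp(2) _ leaf]) (use v v_def in simp)
  note S = prune_step_simps[OF m_def v_def e_def p_def vp(2), folded s'_def]
  have len: "rarr s ''len'' e = l {v, p}" using D(5)[OF e(1)] vp by simp
  have hist: "history s' k = history s k" if "k \<le> m" for k
    by (rule history_cong) (use that in \<open>simp add: S\<close>)
  have h': "history s' (Suc m) = h @ [(v, p)]"
    by (simp add: history_Suc hist S h_def)
  have A': "summarises (entry s' ''A'' u) (cluster (h @ [(v, p)]) u) u"
    if "u \<in> remaining (h @ [(v, p)])" for u
    using summarises_prune[OF pr' A that] by (auto simp: S len)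
  have inc: "incident (alive (remaining h - {v})) u =
      (if u \<in> {v, p} then incident (alive (remaining h)) u - {e} else incident (alive (remaining h)) u)"
    for u
  proof -
    have "alive (remaining h - {v}) = alive (remaining h) - incident (alive (remaining h)) v"
      by (auto simp: alive_def incident_def)
    also have "\<dots> = alive (remaining h) - {e}" by (simp add: j \<open>e = j\<close>)
    finally show ?thesis using vp by (auto simp: incident_def)
  qed
  \<comment> \<open>As \<open>e\<close> is counted at both ends, the truncated subtractions from
    degree and index sum are exact.\<close>
  have e_inc: "e \<in> incident (alive (remaining h)) u" if "u \<in> {v, p}" for u
    using that e vp by (auto simp: incident_def alive_def)
  have deg': "degrees s' (alive (remaining h - {v}))"
    unfolding degrees_def
  proof (intro allI impI)
    fix u assume u: "u < n"
    note du = deg[unfolded degrees_def, rule_format, OF u]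
    show "narr s' ''deg'' u = card (incident (alive (remaining h - {v})) u) \<and>
        narr s' ''inc'' u = \<Sum> (incident (alive (remaining h - {v})) u)"
    proof (cases "u \<in> {v, p}")
      case True
      then have "narr s' ''deg'' u = narr s ''deg'' u - 1" "narr s' ''inc'' u = narr s ''inc'' u - e"
        using vp(2) by (auto simp: S)
      then show ?thesis
        using True du e_inc[OF True]
        by (simp add: inc sum_diff1_nat)
    next
      case False
      then show ?thesis using du by (auto simp: inc S)
    qed
  qed
  \<comment> \<open>\<open>p\<close> still remains, so overwriting its entry of \<open>A\<close>
    leaves those of earlier pruned vertices intact.\<close>
  have notin: "narr s ''ord'' k \<noteq> p" if "k < m" for k
  proof -
    have "narr s ''ord'' k \<in> fst ` set h" using that by (force simp: h_def history_def)
    then show ?thesis using rem(2) by (auto simp: remaining_def)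
  qed
  have rec': "recorded s' (Suc m)"
    unfolding recorded_def
  proof (intro allI impI)
    fix k assume k: "k < Suc m"
    show "narr s' ''eid'' k < n - 1 \<and> edge (narr s' ''eid'' k) = {narr s' ''ord'' k, narr s' ''par'' k} \<and>
      summarises (entry s' ''A'' (narr s' ''ord'' k))
        (cluster (history s' k) (narr s' ''ord'' k)) (narr s' ''ord'' k) \<and>
      summarises (entry s' ''P'' k) (cluster (history s' k) (narr s' ''par'' k)) (narr s' ''par'' k)"
    proof (cases "k = m")
      case True
      then show ?thesis using e vp A[OF rem(1)] A[OF rem(2)] by (simp add: S hist h_def)
    next
      case False
      with k have "k < m" by simp
      then show ?thesis using rec notin by (simp add: S hist recorded_def)
    qed
  qed
  \<comment> \<open>Among the vertices left, only the degree of \<open>p\<close> has changed, and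
    \<open>p\<close> is the new \<open>v\<close>.\<close>
  have leaves': "u = p \<or> nvar s ''i'' < u"
    if u: "u \<in> remaining h - {v}" "u \<noteq> 0" "narr s' ''deg'' u = 1" for u
    using leaves[of u] u by (cases "u = p") (auto simp: S)
  have "same_input s'" using si by (simp add: same_input_def S)
  moreover have "Suc (Suc m) \<le> n" using more by (simp add: m_def)
  ultimately have "forward_inv s'"
    using i rem pr' A' deg' rec' leaves'
    unfolding forward_inv_def Let_def S(8) h' by (simp add: S)
  then show ?thesis by (simp add: s'_def)
qed

text \<open>More than one vertex remains, so there is a leaf \<open>u\<close> other than the root.
  The current \<open>v\<close> failed the test and is not that leaf, so the invariant puts
  \<open>u\<close> ahead of the scan, which can therefore advance within range.\<close>

lemma skip_step_correct:
  assumes I: "forward_inv s" and v: "\<not> (0 < nvar s ''v'' \<and> narr s ''deg'' (nvar s ''v'') = 1)"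
    and more: "Suc (nvar s ''cnt'') < n"
  defines "s' \<equiv> run (block [inc ''i'', NAssign ''v'' (NVar ''i'')]) s"
  shows "forward_inv s'" "nvar s' ''i'' = Suc (nvar s ''i'')"
proof -
  define h where "h = history s (nvar s ''cnt'')"
  have pr: "pruning 0 h" and deg: "degrees s (alive (remaining h))"
    and leaves: "\<And>u. u \<in> remaining h \<Longrightarrow> u \<noteq> 0 \<Longrightarrow> narr s ''deg'' u = 1 \<Longrightarrow>
      u = nvar s ''v'' \<or> nvar s ''i'' < u"
    using I by (auto simp: forward_inv_def Let_def h_def)
  have "length h = nvar s ''cnt''" by (simp add: h_def)
  then obtain u p where u: "u \<in> remaining h" "u \<noteq> 0"
      "{e \<in> E. e \<subseteq> remaining h \<and> u \<in> e} = {{u, p}}"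
    using pruning_leaf[OF pr] more by auto
  then have un: "u < n" by (simp add: remaining_def)
  have "narr s ''deg'' u = 1" using deg un card_incident[of "remaining h" u] u(3)
    by (simp add: degrees_def)
  with leaves u v have "nvar s ''i'' < u" by auto
  with un have i: "Suc (nvar s ''i'') < n" by simp
  have leaves': "u = Suc (nvar s ''i'') \<or> Suc (nvar s ''i'') < u"
    if "u \<in> remaining h" "u \<noteq> 0" "narr s ''deg'' u = 1" for u
    using leaves[OF that] that v by auto
  have hist: "history s' k = history s k" for k
    by (rule history_cong) (simp add: s'_def)
  have "same_input s' = same_input s" "\<And>I. degrees s' I = degrees s I" "\<And>m. recorded s' m = recorded s m"
    by (simp_all add: same_input_def degrees_def recorded_def hist) (simp_all add: s'_def)
  then show "forward_inv s'"
    using I i leaves' unfolding forward_inv_def Let_def hist by (simp add: s'_def h_def)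
  show "nvar s' ''i'' = Suc (nvar s ''i'')" by (simp add: s'_def)
qed

text \<open>Each step either prunes a vertex or advances the scan, and neither can happen more than
  \<open>n\<close> times; the measure adds the two distances to \<open>n\<close>.\<close>

lemma forward_loop_correct:
  assumes "forward_inv s"
  shows "runs forward_loop s
    ((6 + maxcost forward_step) * (3 * n))
    (\<lambda>s'. forward_inv s' \<and> nvar s' ''cnt'' = n - 1)"
proof -
  let ?b = "NLess (NAdd (NVar ''cnt'') (NConst 1)) (NVar ''n'')"
  let ?m = "\<lambda>s. n - nvar s ''cnt'' + (n - nvar s ''i'')"
  have step: "forward_inv (run forward_step s) \<and> ?m (run forward_step s) < ?m s"
    if I: "forward_inv s" and b: "bval ?b s" for s
  proof -
    have "same_input s" "nvar s ''i'' < n" using I by (auto simp: forward_inv_def Let_def)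
    then have more: "Suc (nvar s ''cnt'') < n" using b by (simp add: same_inputD(1))
    show ?thesis
    proof (cases "bval leaf_test s")
      case True
      then have v: "0 < nvar s ''v''" "narr s ''deg'' (nvar s ''v'') = 1"
        by (simp_all add: leaf_test_def)
      have "nvar (run prune_step s) ''cnt'' = Suc (nvar s ''cnt'')"
        "nvar (run prune_step s) ''i'' = nvar s ''i''"
        by (simp_all add: prune_step_def reg_names_def)
      then show ?thesis using prune_step_correct[OF I v more] True more
        by (simp add: forward_step_def)
    next
      case False
      then have v: "\<not> (0 < nvar s ''v'' \<and> narr s ''deg'' (nvar s ''v'') = 1)"
        by (simp add: leaf_test_def)
      have "nvar (run (block [inc ''i'', NAssign ''v'' (NVar ''i'')]) s) ''cnt'' = nvar s ''cnt''"
        by simp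
      with False skip_step_correct[OF I v more] \<open>nvar s ''i'' < n\<close> show ?thesis
        by (simp add: forward_step_def del: block_simps)
    qed
  qed
  have "runs forward_loop s ((1 + bcost ?b + maxcost forward_step) * Suc (?m s))
      (\<lambda>s'. forward_inv s' \<and> \<not> bval ?b s')"
    unfolding forward_loop_def by (rule runs_While[where I = forward_inv, OF _ step assms]) simp_all
  then show ?thesis
  proof (rule runs_mono)
    show "(1 + bcost ?b + maxcost forward_step) * Suc (?m s) \<le>
        (6 + maxcost forward_step) * (3 * n)"
      using two by (intro mult_le_mono) auto
  qed (auto simp: forward_inv_def same_input_def Let_def)
qed

section \<open>The backward pass\<close>

text \<open>Before the first visit, when \<open>k = n - 1\<close>, no candidate exists, hence the
  disjunction. The complete history is carried along so that every edge can be reached at the end;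
  the sides are existential since the program stores only the edge and the facilities.\<close>

definition backward_inv :: "state \<Rightarrow> bool" where
  "backward_inv s \<longleftrightarrow> (let k = nvar s ''k''; h = history s k in
     same_input s \<and> nvar s ''cnt'' = n - 1 \<and> k \<le> n - 1 \<and>
     pruning 0 (history s (n - 1)) \<and> pruning 0 h \<and> recorded s (n - 1) \<and>
     (\<forall>u\<in>remaining h. summarises (entry s ''B'' u) ({..<n} - cluster h u) u) \<and>
     (k = n - 1 \<or>
      nvar s ''edge'' < n - 1 \<and>
      (\<exists>V1 V2. let S = (edge (nvar s ''edge''), V1, V2, nvar s ''x1'', nvar s ''x2'') in
         feasible {..<n} E S \<and> rvar s ''value'' = f_pmax {..<n} E l w t lam S) \<and>
      (\<forall>j V1 V2 x1 x2. k \<le> j \<longrightarrow> j < n - 1 \<longrightarrow>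
         feasible {..<n} E ({narr s ''ord'' j, narr s ''par'' j}, V1, V2, x1, x2) \<longrightarrow>
         f_pmax {..<n} E l w t lam ({narr s ''ord'' j, narr s ''par'' j}, V1, V2, x1, x2)
           \<le> rvar s ''value'')))"

lemma backward_step_correct:
  assumes I: "backward_inv s" and pos: "0 < nvar s ''k''"
  shows "backward_inv (run backward_step s)"
proof -
  define k v p e c a b obj keep h s' where "k = nvar s ''k'' - 1" and "v = narr s ''ord'' k"
    and "p = narr s ''par'' k" and "e = narr s ''eid'' k" and "c = rarr s ''len'' e"
    and "a = entry s ''A'' v" and "b = join (entry s ''P'' k) (entry s ''B'' p)"
    and "obj = edge_value (rvar s ''lambda'') c a b"
    and "keep \<longleftrightarrow> Suc k < nvar s ''cnt'' \<and> obj \<le> rvar s ''value''"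
    and "h = history s k" and "s' = run backward_step s"
  note S = backward_step_simps[OF k_def v_def p_def e_def c_def a_def b_def obj_def keep_def,
      folded s'_def]
  have k: "nvar s ''k'' = Suc k" using pos by (simp add: k_def)
  have hk: "history s (Suc k) = h @ [(v, p)]" by (simp add: history_Suc h_def v_def p_def)
  have si: "same_input s" and kn: "k < n - 1" and cnt: "nvar s ''cnt'' = n - 1"
    and prn: "pruning 0 (history s (n - 1))" and pr: "pruning 0 (h @ [(v, p)])"
    and rec: "recorded s (n - 1)"
    and B: "\<And>u. u \<in> remaining (h @ [(v, p)]) \<Longrightarrow>
      summarises (entry s ''B'' u) ({..<n} - cluster (h @ [(v, p)]) u) u"
    and best: "Suc k < n - 1 \<Longrightarrow> nvar s ''edge'' < n - 1"
      "Suc k < n - 1 \<Longrightarrow>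
       \<exists>V1 V2. let S = (edge (nvar s ''edge''), V1, V2, nvar s ''x1'', nvar s ''x2'') in
         feasible {..<n} E S \<and> rvar s ''value'' = f_pmax {..<n} E l w t lam S"
      "\<And>j V1 V2 x1 x2. Suc k \<le> j \<Longrightarrow> j < n - 1 \<Longrightarrow>
         feasible {..<n} E ({narr s ''ord'' j, narr s ''par'' j}, V1, V2, x1, x2) \<Longrightarrow>
         f_pmax {..<n} E l w t lam ({narr s ''ord'' j, narr s ''par'' j}, V1, V2, x1, x2)
           \<le> rvar s ''value''"
    using I unfolding backward_inv_def Let_def k hk by auto
  note D = same_inputD[OF si]
  have e: "e < n - 1" "edge e = {v, p}" and a: "summarises a (cluster h v) v"
    and m: "summarises (entry s ''P'' k) (cluster h p) p"
    using rec kn by (auto simp: recorded_def e_def v_def p_def a_def h_def)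
  have c: "c = l {v, p}" using D(5)[OF e(1)] e(2) by (simp add: c_def)
  note br = pruning_bridge[OF pr] and P = pruning_snocD[OF pr]
  have "summarises (entry s ''B'' p) ({..<n} - cluster (h @ [(v, p)]) p) p" using B[of p] P by simp
  then have b: "summarises b ({..<n} - cluster h v) p"
    unfolding b_def by (rule summarises_outside[OF pr m])
  have obj: "obj = edge_value lam (l {v, p}) a b" by (simp add: obj_def D(2) c)
  note opt = edge_optimum[OF a b br, folded obj]
  have hist: "history s' j = history s j" for j by (rule history_cong) (simp add: S)
  have B': "summarises (entry s' ''B'' u) ({..<n} - cluster h u) u" if "u \<in> remaining h" for u
    using summarises_unprune[OF pr a m B that] P(4)
    by (auto simp: S(1) b_def[symmetric] c split: if_splits)
  have si': "same_input s'" using si by (simp add: same_input_def S)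
  have rec': "recorded s' (n - 1)" using rec by (simp add: recorded_def S hist)
  have "nvar s' ''edge'' < n - 1 \<and>
      (\<exists>V1 V2. let S = (edge (nvar s' ''edge''), V1, V2, nvar s' ''x1'', nvar s' ''x2'') in
         feasible {..<n} E S \<and> rvar s' ''value'' = f_pmax {..<n} E l w t lam S)"
  proof (cases keep)
    case True
    then show ?thesis using best(1,2) cnt by (simp add: S(3-6) keep_def)
  next
    case False
    then show ?thesis using e opt(1,2) unfolding S(3-6) Let_def if_not_P[OF False] by metis
  qed
  moreover have "f_pmax {..<n} E l w t lam ({narr s ''ord'' j, narr s ''par'' j}, V1, V2, x1, x2)
      \<le> rvar s' ''value''"
    if j: "k \<le> j" "j < n - 1"
      and f: "feasible {..<n} E ({narr s ''ord'' j, narr s ''par'' j}, V1, V2, x1, x2)"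
    for j V1 V2 x1 x2
  proof (cases "j = k")
    case True
    then have "f_pmax {..<n} E l w t lam ({narr s ''ord'' j, narr s ''par'' j}, V1, V2, x1, x2) \<le> obj"
      using opt(3) f by (simp only: v_def p_def)
    then show ?thesis by (auto simp: S(3) keep_def)
  next
    case False
    \<comment> \<open>Edge \<open>j\<close> has been visited already, so this is not the first visit
      and \<open>value\<close> does not drop.\<close>
    with j have "Suc k \<le> j" by simp
    from best(3)[OF this j(2) f] this j(2) show ?thesis by (auto simp: S(3) keep_def cnt)
  qed
  ultimately have "backward_inv s'"
    using si' rec' kn prn P(1) B' cnt
    unfolding backward_inv_def Let_def S(2) hist by (simp add: S(7,9) h_def)
  then show ?thesis by (simp add: s'_def)
qed

lemma backward_loop_correct:
  assumes "backward_inv s"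
  shows "runs backward_loop s ((4 + maxcost backward_step) * (3 * n))
    (\<lambda>s'. backward_inv s' \<and> nvar s' ''k'' = 0)"
proof -
  let ?b = "NLess (NConst 0) (NVar ''k'')"
  have step: "backward_inv (run backward_step s) \<and> nvar (run backward_step s) ''k'' < nvar s ''k''"
    if "backward_inv s" "bval ?b s" for s
    using backward_step_correct[OF that(1)] that(2)
      backward_step_simps(2)[OF refl refl refl refl refl refl refl refl refl, of s] by simp
  have "runs backward_loop s ((1 + bcost ?b + maxcost backward_step) * Suc (nvar s ''k''))
      (\<lambda>s'. backward_inv s' \<and> \<not> bval ?b s')"
    unfolding backward_loop_def by (rule runs_While[where I = backward_inv, OF _ step assms]) simp_all
  then show ?thesis
  proof (rule runs_mono)
    show "(1 + bcost ?b + maxcost backward_step) * Suc (nvar s ''k'') \<le>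
        (4 + maxcost backward_step) * (3 * n)"
      using two assms by (intro mult_le_mono) (auto simp: backward_inv_def Let_def)
  qed auto
qed

text \<open>At \<open>k = 0\<close> the bound covers all recorded edges, and by
  \<open>pruning_complete\<close> these are all edges of the tree. As \<open>n \<ge> 2\<close>, a
  candidate exists.\<close>

lemma backward_inv_optimum:
  assumes I: "backward_inv s" and k: "nvar s ''k'' = 0"
  shows "holds_optimum s0 s n E l w t lam"
proof -
  have pr: "pruning 0 (history s (n - 1))" using I by (simp add: backward_inv_def Let_def)
  obtain V1 V2 where e: "nvar s ''edge'' < n - 1"
    and f: "feasible {..<n} E (edge (nvar s ''edge''), V1, V2, nvar s ''x1'', nvar s ''x2'')"
      "rvar s ''value'' =
         f_pmax {..<n} E l w t lam (edge (nvar s ''edge''), V1, V2, nvar s ''x1'', nvar s ''x2'')"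
    and max: "\<And>j V1 V2 x1 x2. j < n - 1 \<Longrightarrow>
         feasible {..<n} E ({narr s ''ord'' j, narr s ''par'' j}, V1, V2, x1, x2) \<Longrightarrow>
         f_pmax {..<n} E l w t lam ({narr s ''ord'' j, narr s ''par'' j}, V1, V2, x1, x2)
           \<le> rvar s ''value''"
    using I k two unfolding backward_inv_def Let_def by auto
  have "f_pmax {..<n} E l w t lam sol \<le> rvar s ''value''" if sol: "feasible {..<n} E sol" for sol
  proof -
    obtain e V1 V2 x1 x2 where s: "sol = (e, V1, V2, x1, x2)" by (metis prod_cases5)
    with sol have "e \<in> E" by (simp add: splits_def)
    then have "\<exists>(v, p)\<in>set (history s (n - 1)). e = {v, p}"
      using two by (intro pruning_complete(2)[OF pr]) auto
    then obtain j where "j < n - 1" "e = {narr s ''ord'' j, narr s ''par'' j}"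
      by (auto simp: history_def)
    with max sol s show ?thesis by blast
  qed
  with f have "optimal {..<n} E l w t lam
      (edge (nvar s ''edge''), V1, V2, nvar s ''x1'', nvar s ''x2'')"
    unfolding optimal_def by metis
  with e f(2) show ?thesis unfolding holds_optimum_def Let_def card_E by blast
qed

section \<open>Preparation of the passes and composition\<close>

lemma prepare_forward_correct:
  assumes I: "count_inv s" and i: "nvar s ''i'' = n - 1"
  shows "forward_inv (run prepare_forward s)"
proof -
  let ?s = "run prepare_forward s"
  have rem: "remaining [] = {..<n}" by (simp add: remaining_def)
  have "alive {..<n} = {..<n - 1}"
    using edge_in_E edge_subset by (auto simp: alive_def)
  then have "degrees ?s (alive {..<n})"
    using I i by (simp add: count_inv_def degrees_def prepare_forward_def)
  moreover have "same_input ?s" using I by (simp add: count_inv_def same_input_def prepare_forward_def)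
  moreover have "summarises (entry ?s ''A'' u) (cluster [] u) u" if "u < n" for u
  proof -
    have "entry ?s ''A'' u = (w u, w u * t u, 0, 0, u)"
      using I that by (simp add: count_inv_def prepare_forward_def)
    then show ?thesis using summarises_singleton[of u] cluster_Nil[of u] that by simp
  qed
  moreover have "recorded ?s 0" by (simp add: recorded_def)
  \<comment> \<open>With \<open>i = v = 0\<close> every vertex except the root lies ahead of the
    scan, which gives the last conjunct of the invariant.\<close>
  moreover have "nvar ?s ''cnt'' = 0" "nvar ?s ''i'' = 0" "nvar ?s ''v'' = 0"
    by (simp_all add: prepare_forward_def)
  ultimately show ?thesis
    using two pruning.Nil unfolding forward_inv_def Let_def by (simp add: rem)
qed

lemma prepare_backward_correct:
  assumes I: "forward_inv s" and cnt: "nvar s ''cnt'' = n - 1"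
  shows "backward_inv (run prepare_backward s)"
proof -
  let ?s = "run prepare_backward s"
  let ?h = "history s (n - 1)"
  have pr: "pruning 0 ?h" and rec: "recorded s (n - 1)" and si: "same_input s"
    using I by (auto simp: forward_inv_def Let_def cnt)
  have hist: "history ?s k = history s k" for k
    by (rule history_cong) (simp add: prepare_backward_def)
  have "remaining ?h = {0}" "cluster ?h 0 = {..<n}"
    using pruning_complete(1)[OF pr] cluster_root[OF pr] two by auto
  moreover have "entry ?s ''B'' 0 = (0, 0, 0, -1, 0)"
    by (simp add: prepare_backward_def reg_names_def)
  ultimately have "summarises (entry ?s ''B'' u) ({..<n} - cluster ?h u) u" if "u \<in> remaining ?h" for u
    using that by simp
  moreover have "same_input ?s" using si by (simp add: same_input_def prepare_backward_def reg_names_def)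
  moreover have "recorded ?s (n - 1)"
    using rec by (simp add: recorded_def hist) (simp add: prepare_backward_def)
  moreover have "nvar ?s ''cnt'' = n - 1" "nvar ?s ''k'' = n - 1"
    by (simp_all add: prepare_backward_def cnt)
  ultimately show ?thesis
    using pr unfolding backward_inv_def Let_def by (simp add: hist)
qed

lemma solve_correct: "runs solve s0 (solve_cost * n) (\<lambda>s. holds_optimum s0 s n E l w t lam)"
proof -
  have i0: "runs (NAssign ''i'' (NConst 0)) s 2 (\<lambda>s'. s' = run (NAssign ''i'' (NConst 0)) s)" for s
    using runs_run[of "NAssign ''i'' (NConst 0)" s] by (simp add: numeral_2_eq_2)
  have "runs solve s0 (2 + ((4 + maxcost init_step) * (3 * n) +
      (2 + ((6 + maxcost count_step) * (3 * n) + (maxcost prepare_forward +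
      ((6 + maxcost forward_step) * (3 * n) + (maxcost prepare_backward +
       (4 + maxcost backward_step) * (3 * n))))))))
    (\<lambda>s. backward_inv s \<and> nvar s ''k'' = 0)"
    unfolding solve_def
  proof (intro runs_Seq)
    show "runs (NAssign ''i'' (NConst 0)) s0 2 (\<lambda>s'. s' = run (NAssign ''i'' (NConst 0)) s0)"
      by (rule i0)
    show "runs init_loop s ((4 + maxcost init_step) * (3 * n))
        (\<lambda>s. init_inv s \<and> nvar s ''i'' = n)" if "s = run (NAssign ''i'' (NConst 0)) s0" for s
      using same_input_s0 that by (intro init_loop_correct) (simp add: init_inv_def same_input_def)
    show "runs (NAssign ''i'' (NConst 0)) s 2 count_inv" if "init_inv s \<and> nvar s ''i'' = n" for s
      using that two by (intro runs_mono[OF i0])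
        (auto simp: init_inv_def count_inv_def same_input_def degrees_def incident_def)
    show "runs count_loop s ((6 + maxcost count_step) * (3 * n))
        (\<lambda>s. count_inv s \<and> nvar s ''i'' = n - 1)" if "count_inv s" for s
      using that by (rule count_loop_correct)
    show "runs prepare_forward s (maxcost prepare_forward) forward_inv"
      if "count_inv s \<and> nvar s ''i'' = n - 1" for s
      using that prepare_forward_correct
      by (intro runs_mono[OF runs_run]) (auto simp: prepare_forward_def)
    show "runs forward_loop s ((6 + maxcost forward_step) * (3 * n))
        (\<lambda>s. forward_inv s \<and> nvar s ''cnt'' = n - 1)" if "forward_inv s" for s
      using that by (rule forward_loop_correct)
    show "runs prepare_backward s (maxcost prepare_backward) backward_inv"
      if "forward_inv s \<and> nvar s ''cnt'' = n - 1" for s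
      using that prepare_backward_correct
      by (intro runs_mono[OF runs_run]) (auto simp: prepare_backward_def)
    show "runs backward_loop s ((4 + maxcost backward_step) * (3 * n))
        (\<lambda>s. backward_inv s \<and> nvar s ''k'' = 0)" if "backward_inv s" for s
      using that by (rule backward_loop_correct)
  qed
  then show ?thesis
  proof (rule runs_mono)
    have "c \<le> c * n" for c using two by simp
    from this[of "4 + maxcost prepare_forward + maxcost prepare_backward"]
    show "2 + ((4 + maxcost init_step) * (3 * n) +
      (2 + ((6 + maxcost count_step) * (3 * n) + (maxcost prepare_forward +
      ((6 + maxcost forward_step) * (3 * n) + (maxcost prepare_backward +
       (4 + maxcost backward_step) * (3 * n))))))) \<le> solve_cost * n"
      by (simp add: solve_cost_def algebra_simps)
  qed (auto intro: backward_inv_optimum)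
qed

end

theorem theorem2:
  shows "\<exists>(prog :: com) (C :: nat).
    \<forall>(n :: nat) (E :: nat set set) (l :: nat set \<Rightarrow> real) (w :: nat \<Rightarrow> real) (t :: nat \<Rightarrow> real)
      (lam :: real) (s :: state).
      2 \<le> n \<and> is_tree {..<n} E \<and>
      (\<forall>e\<in>E. 0 \<le> l e) \<and> (\<forall>v<n. 0 \<le> w v) \<and> (\<forall>v<n. 0 \<le> t v) \<and>
      0 \<le> lam \<and> lam \<le> 1 \<and>
      holds_input s n E l w t lam \<longrightarrow>
      (\<exists>k s'. exec prog s k s' \<and> k \<le> C * n \<and> holds_optimum s s' n E l w t lam)"
proof (rule exI[of _ solve], rule exI[of _ solve_cost], intro allI impI, elim conjE)
  fix n E l w t lam s
  assume "2 \<le> n" "is_tree {..<n} E" "\<forall>e\<in>E. 0 \<le> l e" "\<forall>v<n. 0 \<le> w v" "0 \<le> lam"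
    "holds_input s n E l w t lam"
  then interpret maxian_instance n E l w t lam s by unfold_locales auto
  show "\<exists>k s'. exec solve s k s' \<and> k \<le> solve_cost * n \<and> holds_optimum s s' n E l w t lam"
    using solve_correct by (simp add: runs_def)
qed

end
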